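(* Fix two density profiles $\gamma^1,\gamma^2:\mathbb{T}\to[l,r]$ and denote by $\rho^1,\rho^2$ weak solutions of $$\partial_t\rho=\mathcal{L}_W\Phi(\rho),\qquad \rho(0,\cdot)=\gamma(\cdot)$$ with initial value $\gamma=\gamma^1$ and $\gamma=\gamma^2$, respectively. Then $$\big\langle\rho^1_t-\rho^2_t,\,G_\lambda[\rho^1_t-\rho^2_t]\big\rangle\le\big\langle\gamma^1-\gamma^2,\,G_\lambda[\gamma^1-\gamma^2]\big\rangle\,e^{B\lambda t/2}$$ for all $\lambda>0$, $t>0$. In particular, for each initial profile $\gamma$ there exists at most one weak solution of this equation.
   Context: $\mathbb{T}=[0,1)$ is the one-dimensional torus and $\langle\cdot,\cdot\rangle$ the inner product of $L^2(\mathbb{T})$. $W:\mathbb{R}\to\mathbb{R}$ is a fixed strictly increasing, right continuous with left limits function with $W(u+1)-W(u)=W(1)-W(0)$ for all $u\in\mathbb{R}$ and $W(0)=0$. $\mathcal{D}_W$ is the set of $f\in L^2(\mathbb{T})$ such that $f(x)=c+bW(x)+\int_{(0,x]}W(dy)\int_0^y\mathfrak{f}(z)\,dz$ for some $c,b\in\mathbb{R}$ and some $\mathfrak{f}\in L^2(\mathbb{T})$ with $\int_0^1\mathfrak{f}(z)\,dz=0$ and $\int_{(0,1]}W(dy)\{b+\int_0^y\mathfrak{f}(z)\,dz\}=0$; the operator $\mathcal{L}_W:\mathcal{D}_W\to L^2(\mathbb{T})$ is $\mathcal{L}_Wf=\mathfrak{f}$. It is self-adjoint, non-positive, and generates a strongly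 continuous contraction semigroup; for $\lambda>0$, $G_\lambda=(\lambda-\mathcal{L}_W)^{-1}:L^2(\mathbb{T})\to L^2(\mathbb{T})$ is its resolvent. Fix $l<r$ and a smooth function $\Phi:[l,r]\to\mathbb{R}$ with $0<B^{-1}\le\Phi'(u)\le B$ for $u\in[l,r]$, where $B$ is a finite constant. For a bounded density profile $\gamma:\mathbb{T}\to[l,r]$, a bounded function $\rho:\mathbb{R}_+\times\mathbb{T}\to[l,r]$, $\rho_t=\rho(t,\cdot)$, is a weak solution of $\partial_t\rho=\mathcal{L}_W\Phi(\rho)$, $\rho(0,\cdot)=\gamma$, if for all $H\in C^1(\mathbb{T})$, all $t>0$ and all $\lambda>0$, $$\langle\rho_t,G_\lambda H\rangle-\langle\gamma,G_\lambda H\rangle=\int_0^t\langle\Phi(\rho_s),\mathcal{L}_WG_\lambda H\rangle\,ds.$$ *)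

theory Defs
  imports "HOL-Analysis.Analysis"
begin

text \<open>
  A function on the torus is a function of type \<^typ>\<open>real \<Rightarrow> real\<close> of which only the values on
  \<open>[0,1)\<close> matter, and an element of \<open>L\<^sup>2\<close> of the torus is represented by any of its Lebesgue
  measurable representatives; equality in \<open>L\<^sup>2\<close> is equality almost everywhere.
\<close>

abbreviation torus :: "real measure" where
  "torus \<equiv> lebesgue_on {0..<1}"

definition L2_torus :: "(real \<Rightarrow> real) set" where
  "L2_torus = {f. f \<in> borel_measurable torus \<and> integrable torus (\<lambda>x. (f x)\<^sup>2)}"

definition inner_torus :: "(real \<Rightarrow> real) \<Rightarrow> (real \<Rightarrow> real) \<Rightarrow> real" where
  "inner_torus f g = (LINT x|torus. f x * g x)"

definition C1_torus :: "(real \<Rightarrow> real) set" where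
  "C1_torus = {H. (\<forall>x. H (x + 1) = H x) \<and> H C1_differentiable_on UNIV}"

definition conductance_function :: "(real \<Rightarrow> real) \<Rightarrow> bool" where
  "conductance_function W \<longleftrightarrow>
     strict_mono W \<and>
     (\<forall>u. continuous (at_right u) W) \<and>
     (\<forall>u. \<exists>v. (W \<longlongrightarrow> v) (at_left u)) \<and>
     (\<forall>u. W (u + 1) - W u = W 1 - W 0) \<and>
     W 0 = 0"

text \<open>
  \<^term>\<open>LW_graph W f \<ff>\<close> says that \<open>f\<close> lies in the domain of \<open>L\<^sub>W\<close> and is sent to \<open>\<ff>\<close>. The
  measure \<open>W(dy)\<close> is the Lebesgue-Stieltjes measure \<^term>\<open>interval_measure W\<close>, which gives
  \<open>(a,b]\<close> the mass \<open>W b - W a\<close>.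
\<close>

definition LW_graph :: "(real \<Rightarrow> real) \<Rightarrow> (real \<Rightarrow> real) \<Rightarrow> (real \<Rightarrow> real) \<Rightarrow> bool" where
  "LW_graph W f \<ff> \<longleftrightarrow>
     f \<in> L2_torus \<and> \<ff> \<in> L2_torus \<and>
     (LINT z|torus. \<ff> z) = 0 \<and>
     (\<exists>c b.
        (LINT y:{0<..1}|interval_measure W. b + (LINT z:{0..<y}|lebesgue. \<ff> z)) = 0 \<and>
        (AE x in torus. f x = c + b * W x +
           (LINT y:{0<..x}|interval_measure W. (LINT z:{0..<y}|lebesgue. \<ff> z))))"

definition LW_domain :: "(real \<Rightarrow> real) \<Rightarrow> (real \<Rightarrow> real) set" where
  "LW_domain W = {f. \<exists>\<ff>. LW_graph W f \<ff>}"

text \<open>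
  For a conductance function \<open>W\<close>, the function \<open>\<ff>\<close> is determined by \<open>f\<close> up to a null set, and for
  \<open>lam > 0\<close> so is the solution \<open>g\<close> of \<open>lam g - L\<^sub>W g = H\<close> by \<open>H\<close>. In both definitions below the
  choice operator hence only selects a representative of an element of \<open>L\<^sup>2\<close>.
\<close>

definition LW :: "(real \<Rightarrow> real) \<Rightarrow> (real \<Rightarrow> real) \<Rightarrow> (real \<Rightarrow> real)" where
  "LW W f = (SOME \<ff>. LW_graph W f \<ff>)"

definition resolvent :: "(real \<Rightarrow> real) \<Rightarrow> real \<Rightarrow> (real \<Rightarrow> real) \<Rightarrow> (real \<Rightarrow> real)" where
  "resolvent W lam H =
     (SOME g. g \<in> LW_domain W \<and> (AE x in torus. lam * g x - LW W g x = H x))"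

text \<open>Infinitely differentiable on \<open>[l,r]\<close>, with one-sided derivatives at the end points.\<close>

definition smooth_on_Icc :: "real \<Rightarrow> real \<Rightarrow> (real \<Rightarrow> real) \<Rightarrow> bool" where
  "smooth_on_Icc l r \<Phi> \<longleftrightarrow>
     (\<exists>D :: nat \<Rightarrow> real \<Rightarrow> real.
        (\<forall>u\<in>{l..r}. D 0 u = \<Phi> u) \<and>
        (\<forall>n. \<forall>u\<in>{l..r}. (D n has_real_derivative D (Suc n) u) (at u within {l..r})))"

definition density_profile :: "real \<Rightarrow> real \<Rightarrow> (real \<Rightarrow> real) \<Rightarrow> bool" where
  "density_profile l r \<gamma> \<longleftrightarrow>
     \<gamma> \<in> borel_measurable torus \<and> (\<forall>x\<in>{0..<1}. \<gamma> x \<in> {l..r})"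

text \<open>
  The only measurability required of \<open>\<rho>\<close> is what gives a meaning to the integrals: every
  \<open>\<rho>\<^sub>t\<close> is measurable, and the integrand of the time integral is integrable. Both hold when
  \<open>\<rho>\<close> is jointly Borel measurable. Without the integrability clause the time integral of a
  non-measurable integrand would be \<open>0\<close> by convention.
\<close>

definition weak_solution ::
  "(real \<Rightarrow> real) \<Rightarrow> (real \<Rightarrow> real) \<Rightarrow> real \<Rightarrow> real \<Rightarrow> (real \<Rightarrow> real) \<Rightarrow> (real \<Rightarrow> real \<Rightarrow> real) \<Rightarrow> bool" where
  "weak_solution W \<Phi> l r \<gamma> \<rho> \<longleftrightarrow>
     (\<forall>t\<ge>0. \<rho> t \<in> borel_measurable torus) \<and>
     (\<forall>t\<ge>0. \<forall>x\<in>{0..<1}. \<rho> t x \<in> {l..r}) \<and>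
     (\<forall>H\<in>C1_torus. \<forall>t>0. \<forall>lam>0.
        set_integrable lebesgue {0..t}
          (\<lambda>s. inner_torus (\<lambda>x. \<Phi> (\<rho> s x)) (LW W (resolvent W lam H))) \<and>
        inner_torus (\<rho> t) (resolvent W lam H) - inner_torus \<gamma> (resolvent W lam H) =
          (LINT s:{0..t}|lebesgue. inner_torus (\<lambda>x. \<Phi> (\<rho> s x)) (LW W (resolvent W lam H))))"

end

theory Submission imports Defs begin

text \<open>
  Write \<open>U\<^sub>t = \<rho>\<^sup>1\<^sub>t - \<rho>\<^sup>2\<^sub>t\<close>, \<open>F\<^sub>t = \<Phi>(\<rho>\<^sup>1\<^sub>t) - \<Phi>(\<rho>\<^sup>2\<^sub>t)\<close>, \<open>G = (lam - L\<^sub>W)\<^sup>-\<^sup>1\<close> for the resolvent and \<open>A = L\<^sub>W G\<close>, so that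
  \<open>A h = lam G h - h\<close>. The quantity \<open>N(t) = \<langle>U\<^sub>t, G U\<^sub>t\<rangle>\<close> is a squared dual norm, and formally
  \<open>N'(t) = 2 \<langle>F\<^sub>t, A U\<^sub>t\<rangle> = 2 lam \<langle>F\<^sub>t, G U\<^sub>t\<rangle> - 2 \<langle>F\<^sub>t, U\<^sub>t\<rangle>\<close>.
  Since \<open>0 \<le> \<Phi>' \<le> B\<close>, pointwise \<open>F\<^sup>2 \<le> B F U\<close>, hence \<open>\<langle>F, F\<rangle> \<le> B \<langle>F, U\<rangle>\<close>. Expanding
  \<open>0 \<le> \<langle>F - s U, G (F - s U)\<rangle>\<close> and using \<open>lam \<langle>F, G F\<rangle> \<le> \<langle>F, F\<rangle>\<close> with \<open>s = B/2\<close>, bounds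
  \<open>2 lam \<langle>F, G U\<rangle>\<close> by \<open>(2/B) \<langle>F, F\<rangle> + (lam B/2) N\<close>; the first summand is absorbed, \<open>N' \<le> (lam B/2) N\<close>
  remains, and Gronwall's inequality gives the estimate. For equal initial data \<open>N\<close> vanishes, and
  \<open>\<langle>U, G U\<rangle> = 0\<close> forces \<open>U = 0\<close> almost everywhere.

  Three things have to be supplied to make this rigorous.

  \<^item> The operator. With the flux \<open>p = df/dW = b + \<integral>\<ff>\<close>, Fubini gives
    \<open>\<langle>L\<^sub>W f, g\<rangle> = - \<integral> p\<^sub>f p\<^sub>g dW\<close> (\<open>inner_LW_graph\<close>), from which symmetry, non-positivity and the
    uniqueness of \<open>\<ff>\<close> follow. The equation \<open>lam g - L\<^sub>W g = H\<close> is solved as an initial value problem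
    by a Volterra equation (\<open>volterra_exists\<close>), and the two periodicity conditions are met by
    solving a \<open>2\<times>2\<close> linear system whose determinant cannot vanish, because the homogeneous problem
    has only the trivial solution (\<open>resolvent_graph_exists\<close>).

  \<^item> Density. The weak formulation admits only \<open>C\<^sup>1\<close> test functions but has to be used with
    \<open>h = U\<^sub>s + U\<^sub>t\<close>, and continuity in time of \<open>\<langle>U\<^sub>t, v\<rangle>\<close> is known at first only for \<open>v\<close> in the domain of
    \<open>L\<^sub>W\<close>. Both extensions are instances of one induction principle for bounded measurable functions
    (\<open>bounded_measurable_induct\<close>).

  \<^item> The derivative of \<open>N\<close>. As \<open>G\<close> is symmetric,
    \<open>N(t) - N(s) = \<langle>U\<^sub>t - U\<^sub>s, G (U\<^sub>t + U\<^sub>s)\<rangle> = \<integral>\<^bsub>(s,t]\<^esub> \<langle>F\<^sub>\<tau>, A (U\<^sub>t + U\<^sub>s)\<rangle> d\<tau>\<close> exactly. Summing over a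
    partition and refining it, dominated convergence together with the weak continuity of
    \<open>U\<close> yields the integrated form of the formula for \<open>N'\<close> (\<open>energy_identity\<close>).
\<close>

section \<open>Square integrable and bounded functions on the torus\<close>

interpretation torus: finite_measure torus
  by (rule finite_measure_lebesgue_on, rule bounded_set_imp_lmeasurable) auto

definition Linf_torus :: "(real \<Rightarrow> real) set" where
  "Linf_torus = {h \<in> borel_measurable torus. \<exists>C. \<forall>x\<in>{0..<1}. \<bar>h x\<bar> \<le> C}"

lemma Linf_torusI:
  assumes "h \<in> borel_measurable torus" "\<And>x. x \<in> {0..<1} \<Longrightarrow> \<bar>h x\<bar> \<le> C"
  shows "h \<in> Linf_torus"
  using assms unfolding Linf_torus_def by blast

lemma Linf_torus_measurable: "h \<in> Linf_torus \<Longrightarrow> h \<in> borel_measurable torus"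
  by (auto simp: Linf_torus_def)

lemma Linf_torus_bound:
  assumes "h \<in> Linf_torus"
  shows "\<exists>C\<ge>0. \<forall>x\<in>{0..<1}. \<bar>h x\<bar> \<le> C"
proof -
  obtain C where C: "\<forall>x\<in>{0..<1}. \<bar>h x\<bar> \<le> C"
    using assms unfolding Linf_torus_def by blast
  have "0 \<le> C" using C[rule_format, of 0] by simp
  then show ?thesis using C by blast
qed

lemma L2_torus_measurable: "h \<in> L2_torus \<Longrightarrow> h \<in> borel_measurable torus"
  by (auto simp: L2_torus_def)

lemma borel_imp_torus_measurable: "h \<in> borel_measurable borel \<Longrightarrow> h \<in> borel_measurable torus"
  by (rule measurable_restrict_space1) (rule measurable_completion, simp)

lemma Linf_torus_lincomb:
  assumes "f \<in> Linf_torus" "g \<in> Linf_torus"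
  shows "(\<lambda>x. a * f x + b * g x) \<in> Linf_torus"
proof -
  obtain C where C: "f \<in> borel_measurable torus" "\<And>x. x \<in> {0..<1} \<Longrightarrow> \<bar>f x\<bar> \<le> C"
    using Linf_torus_measurable[OF assms(1)] Linf_torus_bound[OF assms(1)] by blast
  obtain D where D: "g \<in> borel_measurable torus" "\<And>x. x \<in> {0..<1} \<Longrightarrow> \<bar>g x\<bar> \<le> D"
    using Linf_torus_measurable[OF assms(2)] Linf_torus_bound[OF assms(2)] by blast
  show ?thesis
  proof (rule Linf_torusI)
    show "(\<lambda>x. a * f x + b * g x) \<in> borel_measurable torus"
      using C(1) D(1) by measurable
    fix x :: real assume x: "x \<in> {0..<1}"
    have "\<bar>a * f x + b * g x\<bar> \<le> \<bar>a\<bar> * \<bar>f x\<bar> + \<bar>b\<bar> * \<bar>g x\<bar>"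
      by (metis abs_mult abs_triangle_ineq)
    also have "\<dots> \<le> \<bar>a\<bar> * C + \<bar>b\<bar> * D"
      using C(2)[OF x] D(2)[OF x] by (intro add_mono mult_left_mono) auto
    finally show "\<bar>a * f x + b * g x\<bar> \<le> \<bar>a\<bar> * C + \<bar>b\<bar> * D" .
  qed
qed

lemma Linf_torus_indicator: "indicator {a..<b} \<in> Linf_torus"
  by (rule Linf_torusI[where C = 1])
     (auto intro!: borel_imp_torus_measurable simp: indicator_def)

lemma integrable_bounded_mult:
  assumes f: "integrable torus f" and h: "h \<in> Linf_torus"
  shows "integrable torus (\<lambda>x. f x * h x)"
proof -
  obtain C where C: "h \<in> borel_measurable torus" "0 \<le> C" "\<And>x. x \<in> {0..<1} \<Longrightarrow> \<bar>h x\<bar> \<le> C"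
    using Linf_torus_measurable[OF h] Linf_torus_bound[OF h] by blast
  show ?thesis
  proof (rule Bochner_Integration.integrable_bound)
    show "integrable torus (\<lambda>x. C * f x)" using f by simp
    show "(\<lambda>x. f x * h x) \<in> borel_measurable torus"
      using f C(1) by measurable
    show "AE x in torus. norm (f x * h x) \<le> norm (C * f x)"
    proof (intro AE_I2)
      fix x assume "x \<in> space torus"
      then have "\<bar>h x\<bar> \<le> C" by (intro C) simp
      then show "norm (f x * h x) \<le> norm (C * f x)"
        using mult_left_mono[OF _ abs_ge_zero, of "\<bar>h x\<bar>" C "f x"] C(2)
        by (simp add: abs_mult mult.commute)
    qed
  qed
qed

lemma Linf_torus_integrable: "h \<in> Linf_torus \<Longrightarrow> integrable torus h"
  using integrable_bounded_mult[of "\<lambda>_. 1" h] by simp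

lemma Linf_torus_subset_L2: "Linf_torus \<subseteq> L2_torus"
proof
  fix h assume h: "h \<in> Linf_torus"
  show "h \<in> L2_torus"
    using integrable_bounded_mult[OF Linf_torus_integrable[OF h] h] Linf_torus_measurable[OF h]
    by (auto simp: L2_torus_def power2_eq_square)
qed

lemmas Linf_L2 = subsetD[OF Linf_torus_subset_L2]

lemma L2_mult_integrable:
  assumes "f \<in> L2_torus" "g \<in> L2_torus"
  shows "integrable torus (\<lambda>x. f x * g x)"
proof (rule Bochner_Integration.integrable_bound)
  show "integrable torus (\<lambda>x. (f x)\<^sup>2 + (g x)\<^sup>2)"
    using assms by (auto simp: L2_torus_def)
  show "(\<lambda>x. f x * g x) \<in> borel_measurable torus"
    using assms[THEN L2_torus_measurable] by measurable
  show "AE x in torus. norm (f x * g x) \<le> norm ((f x)\<^sup>2 + (g x)\<^sup>2)"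
  proof (intro AE_I2)
    fix x
    have "2 * (\<bar>f x\<bar> * \<bar>g x\<bar>) \<le> (f x)\<^sup>2 + (g x)\<^sup>2"
      using sum_squares_bound[of "\<bar>f x\<bar>" "\<bar>g x\<bar>"] by (simp only: mult.assoc power2_abs)
    moreover have "0 \<le> \<bar>f x\<bar> * \<bar>g x\<bar>" by simp
    ultimately show "norm (f x * g x) \<le> norm ((f x)\<^sup>2 + (g x)\<^sup>2)"
      unfolding real_norm_def abs_mult by linarith
  qed
qed

lemma L2_lincomb:
  assumes "f \<in> L2_torus" "g \<in> L2_torus"
  shows "(\<lambda>x. a * f x + b * g x) \<in> L2_torus"
proof -
  have *: "(\<lambda>x. (a * f x + b * g x)\<^sup>2) = 
      (\<lambda>x. a\<^sup>2 * (f x)\<^sup>2 + b\<^sup>2 * (g x)\<^sup>2 + 2 * a * b * (f x * g x))"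
    by (auto simp: fun_eq_iff power2_eq_square algebra_simps)
  show ?thesis
    using assms L2_mult_integrable[OF assms] unfolding L2_torus_def
    by (auto simp: *)
qed

lemma L2_const: "(\<lambda>_. c) \<in> L2_torus"
  by (simp add: L2_torus_def)

lemma L2_integrable: "f \<in> L2_torus \<Longrightarrow> integrable torus f"
  using L2_mult_integrable[OF _ L2_const[of 1]] by simp

lemma L2_diff: "f \<in> L2_torus \<Longrightarrow> g \<in> L2_torus \<Longrightarrow> (\<lambda>x. f x - g x) \<in> L2_torus"
  using L2_lincomb[of f g 1 "-1"] by simp

lemma inner_lincomb_left:
  assumes "f \<in> L2_torus" "g \<in> L2_torus" "h \<in> L2_torus"
  shows "inner_torus (\<lambda>x. a * f x + b * g x) h = a * inner_torus f h + b * inner_torus g h"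
proof -
  have "(\<lambda>x. (a * f x + b * g x) * h x) = (\<lambda>x. a * (f x * h x) + b * (g x * h x))"
    by (auto simp: algebra_simps)
  then show ?thesis
    using L2_mult_integrable[OF assms(1,3)] L2_mult_integrable[OF assms(2,3)]
    by (simp add: inner_torus_def)
qed

lemma inner_commute: "inner_torus f g = inner_torus g f"
  by (simp add: inner_torus_def mult.commute)

lemma inner_lincomb_right:
  assumes "f \<in> L2_torus" "g \<in> L2_torus" "h \<in> L2_torus"
  shows "inner_torus h (\<lambda>x. a * f x + b * g x) = a * inner_torus h f + b * inner_torus h g"
  using inner_lincomb_left[OF assms] by (simp add: inner_commute)

lemma inner_diff_left:
  assumes "f \<in> L2_torus" "g \<in> L2_torus" "h \<in> L2_torus"
  shows "inner_torus (\<lambda>x. f x - g x) h = inner_torus f h - inner_torus g h"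
  using inner_lincomb_left[OF assms, of 1 "-1"] by simp

lemma inner_diff_right:
  assumes "f \<in> L2_torus" "g \<in> L2_torus" "h \<in> L2_torus"
  shows "inner_torus h (\<lambda>x. f x - g x) = inner_torus h f - inner_torus h g"
  using inner_lincomb_right[OF assms, of 1 "-1"] by simp

lemma inner_cong_AE:
  assumes "AE x in torus. f x = f' x" "AE x in torus. g x = g' x"
    and "f \<in> borel_measurable torus" "f' \<in> borel_measurable torus"
    and "g \<in> borel_measurable torus" "g' \<in> borel_measurable torus"
  shows "inner_torus f g = inner_torus f' g'"
  unfolding inner_torus_def
  using assms by (intro integral_cong_AE) (auto intro: borel_measurable_times)

lemma inner_self_nonneg: "0 \<le> inner_torus f f"
  unfolding inner_torus_def by (rule integral_nonneg_AE) auto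

lemma inner_self_le_0_imp:
  assumes "f \<in> L2_torus" "inner_torus f f \<le> 0"
  shows "AE x in torus. f x = 0"
proof -
  have "(LINT x|torus. f x * f x) = 0"
    using assms(2) inner_self_nonneg[of f] unfolding inner_torus_def by linarith
  then have "AE x in torus. f x * f x = 0"
    using integral_nonneg_eq_0_iff_AE[OF L2_mult_integrable[OF assms(1,1)]] by simp
  then show ?thesis by simp
qed

text \<open>
  The only mode of convergence used below: bounded convergence almost everywhere. Pairing it with an
  integrable function needs no norm estimate, so it passes through operators that can be moved to
  the other side of the inner product.
\<close>

lemma inner_bounded_lim:
  assumes v: "integrable torus v" and fm: "\<And>n. f n \<in> borel_measurable torus"
    and g: "g \<in> Linf_torus" and bd: "\<And>n x. x \<in> {0..<1} \<Longrightarrow> \<bar>f n x\<bar> \<le> C"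
    and lim: "AE x in torus. (\<lambda>n. f n x) \<longlonglongrightarrow> g x"
  shows "(\<lambda>n. inner_torus v (f n)) \<longlonglongrightarrow> inner_torus v g"
  unfolding inner_torus_def
proof (rule integral_dominated_convergence[where w = "\<lambda>x. C * \<bar>v x\<bar>"])
  show "(\<lambda>x. v x * g x) \<in> borel_measurable torus"
    using v Linf_torus_measurable[OF g] by measurable
  show "(\<lambda>x. v x * f n x) \<in> borel_measurable torus" for n
    using v fm[of n] by measurable
  show "integrable torus (\<lambda>x. C * \<bar>v x\<bar>)" using v by simp
  show "AE x in torus. (\<lambda>n. v x * f n x) \<longlonglongrightarrow> v x * g x"
    using lim by eventually_elim (auto intro: tendsto_mult)
  show "AE x in torus. norm (v x * f n x) \<le> C * \<bar>v x\<bar>" for n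
  proof (intro AE_I2)
    fix x assume "x \<in> space torus"
    then have "\<bar>f n x\<bar> \<le> C" by (intro bd) simp
    then show "norm (v x * f n x) \<le> C * \<bar>v x\<bar>"
      using mult_left_mono[OF _ abs_ge_zero, of "\<bar>f n x\<bar>" C "v x"]
      by (simp add: abs_mult mult.commute)
  qed
qed

section \<open>An induction principle for bounded measurable functions\<close>

lemma step_function_sum:
  fixes k :: "real \<Rightarrow> real" and m :: nat
  assumes x: "x \<in> {0..<1}" and m: "m > 0"
  shows "(\<Sum>i<m. k (real i / real m) * indicator {real i / real m..<real (Suc i) / real m} x)
    = k (real (nat \<lfloor>real m * x\<rfloor>) / real m)"
proof -
  define j where "j = nat \<lfloor>real m * x\<rfloor>"
  have j1: "real j \<le> real m * x" "real m * x < real j + 1"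
    using x m unfolding j_def by (auto simp: of_nat_nat)
  have "real m * x < real m" using x m by simp
  then have jm: "j < m" using j1 by linarith
  have iff: "x \<in> {real i / real m..<real (Suc i) / real m} \<longleftrightarrow> i = j" for i
  proof -
    have "x \<in> {real i / real m..<real (Suc i) / real m} \<longleftrightarrow> real i \<le> real m * x \<and> real m * x < real i + 1"
      using m by (auto simp: field_simps)
    also have "\<dots> \<longleftrightarrow> i = j" using j1 by (auto; linarith)
    finally show ?thesis .
  qed
  have "(\<Sum>i<m. k (real i / real m) * indicator {real i / real m..<real (Suc i) / real m} x)
     = (\<Sum>i<m. if i = j then k (real i / real m) else 0)"
    by (rule sum.cong) (auto simp: indicator_def iff[simplified])
  also have "\<dots> = k (real j / real m)" using jm by simp
  finally show ?thesis unfolding j_def .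
qed

text \<open>
  A property of functions on the torus that holds for indicators of intervals and is preserved by
  linear combinations and bounded limits almost everywhere holds for all bounded measurable
  functions: a continuous function is a pointwise limit of step functions, and a Lebesgue measurable
  function is an almost everywhere limit of continuous ones, which can be truncated.
\<close>

lemma bounded_measurable_induct [consumes 1, case_names indicator lincomb lim]:
  assumes h: "h \<in> Linf_torus"
    and ind: "\<And>a b. 0 \<le> a \<Longrightarrow> a < b \<Longrightarrow> b \<le> 1 \<Longrightarrow> P (indicator {a..<b})"
    and lin: "\<And>f g a b. f \<in> Linf_torus \<Longrightarrow> g \<in> Linf_torus \<Longrightarrow> P f \<Longrightarrow> P g \<Longrightarrow>
                P (\<lambda>x. a * f x + b * g x)"
    and lim: "\<And>f g C. (\<And>n. P (f n)) \<Longrightarrow> (\<And>n. f n \<in> borel_measurable torus) \<Longrightarrow>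
                g \<in> Linf_torus \<Longrightarrow> (\<And>n x. x \<in> {0..<1} \<Longrightarrow> \<bar>f n x\<bar> \<le> C) \<Longrightarrow>
                AE x in torus. (\<lambda>n. f n x) \<longlonglongrightarrow> g x \<Longrightarrow> P g"
  shows "P h"
proof -
  have step: "P (\<lambda>x. \<Sum>i<n. c i * indicator {real i / real m..<real (Suc i) / real m} x)
      \<and> (\<lambda>x. \<Sum>i<n. c i * indicator {real i / real m..<real (Suc i) / real m} x) \<in> Linf_torus"
    if "n \<le> m" "m > 0" for c :: "nat \<Rightarrow> real" and m n :: nat
    using that(1)
  proof (induction n)
    case 0
    have "P (\<lambda>x. 0 * indicator {0..<1} x + 0 * indicator {0..<1} x)"
      by (intro lin ind Linf_torus_indicator) auto
    then show ?case using Linf_torusI[of "\<lambda>_. 0" 0] by simp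
  next
    case (Suc n)
    let ?I = "indicator {real n / real m..<real (Suc n) / real m} :: real \<Rightarrow> real"
    have I: "P ?I"
      by (rule ind) (use Suc that in \<open>auto simp: field_simps\<close>)
    have *: "(\<lambda>x. \<Sum>i<Suc n. c i * indicator {real i / real m..<real (Suc i) / real m} x)
       = (\<lambda>x. 1 * (\<Sum>i<n. c i * indicator {real i / real m..<real (Suc i) / real m} x) + c n * ?I x)"
      by simp
    have "n \<le> m" using Suc.prems by simp
    note IH = Suc.IH[OF this]
    show ?case unfolding *
      by (intro conjI lin Linf_torus_lincomb Linf_torus_indicator I IH[THEN conjunct1] IH[THEN conjunct2])
  qed
  have cont: "P k" if k: "continuous_on UNIV k" and bd: "\<And>x. \<bar>k x\<bar> \<le> C" for k C
  proof (rule lim)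
    let ?s = "\<lambda>m x. \<Sum>i<Suc m. k (real i / real (Suc m)) *
        indicator {real i / real (Suc m)..<real (Suc i) / real (Suc m)} x"
    show "P (?s m)" for m
      by (rule step[OF order_refl zero_less_Suc, THEN conjunct1])
    show "?s m \<in> borel_measurable torus" for m
      by (rule Linf_torus_measurable[OF step[OF order_refl zero_less_Suc, THEN conjunct2]])
    show "k \<in> Linf_torus"
      using bd by (intro Linf_torusI[where C = C] borel_imp_torus_measurable
          borel_measurable_continuous_onI k) 
    show "\<bar>?s m x\<bar> \<le> C" if "x \<in> {0..<1}" for m x
      unfolding step_function_sum[OF that zero_less_Suc] by (rule bd)
    show "AE x in torus. (\<lambda>m. ?s m x) \<longlonglongrightarrow> k x"
    proof (intro AE_I2)
      fix x :: real assume "x \<in> space torus"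
      then have x: "x \<in> {0..<1}" by simp
      have "(\<lambda>m. real (nat \<lfloor>real (Suc m) * x\<rfloor>) / real (Suc m)) \<longlonglongrightarrow> x"
      proof (rule tendsto_sandwich)
        show "\<forall>\<^sub>F m in sequentially. x - 1 / real (Suc m) \<le> real (nat \<lfloor>real (Suc m) * x\<rfloor>) / real (Suc m)"
        proof (intro always_eventually allI)
          fix m
          have "real (Suc m) * x - 1 \<le> real (nat \<lfloor>real (Suc m) * x\<rfloor>)" by linarith
          from divide_right_mono[OF this, of "real (Suc m)"]
          show "x - 1 / real (Suc m) \<le> real (nat \<lfloor>real (Suc m) * x\<rfloor>) / real (Suc m)"
            by (simp add: diff_divide_distrib del: of_nat_Suc)
        qed
        show "\<forall>\<^sub>F m in sequentially. real (nat \<lfloor>real (Suc m) * x\<rfloor>) / real (Suc m) \<le> x"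
        proof (intro always_eventually allI)
          fix m
          have "0 \<le> real (Suc m) * x" using x by simp
          then have "real (nat \<lfloor>real (Suc m) * x\<rfloor>) \<le> real (Suc m) * x" by linarith
          then show "real (nat \<lfloor>real (Suc m) * x\<rfloor>) / real (Suc m) \<le> x"
            by (simp add: field_simps del: of_nat_Suc)
        qed
        show "(\<lambda>m. x - 1 / real (Suc m)) \<longlonglongrightarrow> x"
          using tendsto_diff[OF tendsto_const LIMSEQ_inverse_real_of_nat, of x]
          by (simp add: inverse_eq_divide)
      qed simp
      moreover have "isCont k x" using k by (simp add: continuous_on_eq_continuous_at)
      ultimately have "(\<lambda>m. k (real (nat \<lfloor>real (Suc m) * x\<rfloor>) / real (Suc m))) \<longlonglongrightarrow> k x"
        by (rule isCont_tendsto_compose[rotated])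
      then show "(\<lambda>m. ?s m x) \<longlonglongrightarrow> k x"
        unfolding step_function_sum[OF x zero_less_Suc] .
    qed
  qed
  obtain C where C: "h \<in> borel_measurable torus" "0 \<le> C" "\<And>x. x \<in> {0..<1} \<Longrightarrow> \<bar>h x\<bar> \<le> C"
    using Linf_torus_measurable[OF h] Linf_torus_bound[OF h] by blast
  have "h measurable_on {0..<1}"
    using measurable_on_iff_borel_measurable[of "{0..<1}" h] C(1) by simp
  then obtain N k where N: "negligible N" and k: "\<And>n. continuous_on UNIV (k n)"
    and klim: "\<And>x. x \<notin> N \<Longrightarrow> (\<lambda>n. k n x) \<longlonglongrightarrow> (if x \<in> {0..<1} then h x else 0)"
    unfolding measurable_on_def by blast
  \<comment> \<open>truncation at the bound of \<open>h\<close> keeps the limit and makes the convergence bounded\<close>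
  define k' where "k' n x = max (- C) (min C (k n x))" for n x
  have k'c: "continuous_on UNIV (k' n)" for n
    unfolding k'_def by (intro continuous_intros k)
  have k'b: "\<bar>k' n x\<bar> \<le> C" for n x using C(2) by (auto simp: k'_def)
  show "P h"
  proof (rule lim[where C = C and f = k'])
    show "P (k' n)" for n by (rule cont[OF k'c k'b])
    show "k' n \<in> borel_measurable torus" for n
      by (intro borel_imp_torus_measurable borel_measurable_continuous_onI k'c)
    show "AE x in torus. (\<lambda>n. k' n x) \<longlonglongrightarrow> h x"
    proof -
      have "AE x in lebesgue. x \<notin> N"
        using N by (simp add: negligible_iff_null_sets AE_not_in)
      then have "AE x in torus. x \<notin> N"
        by (auto simp: AE_restrict_space_iff elim: eventually_mono)
      moreover have "AE x in torus. x \<in> {0..<1}" by (rule AE_I2) simp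
      ultimately show ?thesis
      proof eventually_elim
        case (elim x)
        then have "(\<lambda>n. k n x) \<longlonglongrightarrow> h x" using klim[of x] by simp
        then have "(\<lambda>n. k' n x) \<longlonglongrightarrow> max (- C) (min C (h x))"
          unfolding k'_def by (intro tendsto_intros)
        moreover have "max (- C) (min C (h x)) = h x" using C(3)[of x] elim by auto
        ultimately show ?case by simp
      qed
    qed
  qed (use h k'b in auto)
qed

section \<open>Primitives\<close>

definition prim :: "(real \<Rightarrow> real) \<Rightarrow> real \<Rightarrow> real" where
  "prim h y = (LINT z:{0..<y}|lebesgue. h z)"

lemma prim_torus: "y \<le> 1 \<Longrightarrow> prim h y = (LINT z|torus. h z * indicator {..<y} z)"
proof -
  assume "y \<le> 1"
  then have *: "indicator {0..<1} z *\<^sub>R (h z * indicator {..<y} z) = indicator {0..<y} z *\<^sub>R h z" for z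
    by (auto simp: indicator_def)
  have "(LINT z|torus. h z * indicator {..<y} z)
      = (LINT z|lebesgue. indicator {0..<1} z *\<^sub>R (h z * indicator {..<y} z))"
    by (rule integral_restrict_space) simp
  then show ?thesis
    by (simp only: prim_def set_lebesgue_integral_def *)
qed

lemma indicator_lessThan_Linf: "indicator {..<y::real} \<in> Linf_torus"
  by (rule Linf_torusI[where C = 1])
     (auto intro!: borel_imp_torus_measurable simp: indicator_def)

lemma prim_lincomb:
  assumes "integrable torus f" "integrable torus g" "y \<le> 1"
  shows "prim (\<lambda>x. a * f x + b * g x) y = a * prim f y + b * prim g y"
proof -
  have "(\<lambda>z. (a * f z + b * g z) * indicator {..<y} z)
    = (\<lambda>z. a * (f z * indicator {..<y} z) + b * (g z * indicator {..<y} z))"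
    by (auto simp: algebra_simps)
  then show ?thesis
    using integrable_bounded_mult[OF assms(1) indicator_lessThan_Linf]
      integrable_bounded_mult[OF assms(2) indicator_lessThan_Linf] assms(3)
    by (simp add: prim_torus)
qed

lemma prim_cong_AE:
  assumes "AE x in torus. f x = g x" "f \<in> borel_measurable torus" "g \<in> borel_measurable torus"
    "y \<le> 1"
  shows "prim f y = prim g y"
  unfolding prim_torus[OF assms(4)]
  using assms Linf_torus_measurable[OF indicator_lessThan_Linf]
  by (intro integral_cong_AE) (auto intro: borel_measurable_times)

lemma prim_0 [simp]: "prim f 0 = 0"
  by (simp add: prim_def set_lebesgue_integral_def)

lemma prim_1: "prim f 1 = (LINT z|torus. f z)"
  unfolding prim_torus[OF order_refl]
  by (rule Bochner_Integration.integral_cong) auto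

lemma abs_prim_le:
  assumes "integrable torus f" "y \<le> 1"
  shows "\<bar>prim f y\<bar> \<le> (LINT z|torus. \<bar>f z\<bar>)"
proof -
  note i = integrable_bounded_mult[OF assms(1) indicator_lessThan_Linf]
  have "\<bar>prim f y\<bar> \<le> (LINT z|torus. \<bar>f z * indicator {..<y} z\<bar>)"
    unfolding prim_torus[OF assms(2)] by (rule integral_abs_bound)
  also have "\<dots> \<le> (LINT z|torus. \<bar>f z\<bar>)"
    using i assms(1) by (intro integral_mono) (auto simp: indicator_def)
  finally show ?thesis .
qed

lemma AE_torus_neq: "AE x in torus. x \<noteq> (a::real)"
proof -
  have "AE x in lebesgue. x \<noteq> a"
    by (rule AE_completion) (rule AE_lborel_singleton)
  then show ?thesis
    by (auto simp: AE_restrict_space_iff elim: eventually_mono)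
qed

lemma continuous_on_prim:
  assumes "integrable torus f"
  shows "continuous_on {..1} (prim f)"
  unfolding continuous_on_sequentially
proof (intro allI ballI impI)
  fix u :: "nat \<Rightarrow> real" and a
  assume a: "a \<in> {..1}" and u: "(\<forall>n. u n \<in> {..1}) \<and> u \<longlonglongrightarrow> a"
  have "(\<lambda>n. LINT z|torus. f z * indicator {..<u n} z) \<longlonglongrightarrow> (LINT z|torus. f z * indicator {..<a} z)"
  proof (rule integral_dominated_convergence[where w = "\<lambda>z. \<bar>f z\<bar>"])
    show "AE z in torus. (\<lambda>n. f z * indicator {..<u n} z) \<longlonglongrightarrow> f z * indicator {..<a} z"
      using AE_torus_neq[of a]
    proof eventually_elim
      case (elim z)
      have "\<forall>\<^sub>F n in sequentially. indicator {..<u n} z = (indicator {..<a} z :: real)"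
      proof (cases "z < a")
        case True
        then show ?thesis using u order_tendstoD(1)[of u a sequentially z]
          by (auto elim!: eventually_mono simp: indicator_def)
      next
        case False
        then have "z > a" using elim by simp
        then show ?thesis using u order_tendstoD(2)[of u a sequentially z]
          by (auto elim!: eventually_mono simp: indicator_def)
      qed
      then show ?case by (intro tendsto_mult tendsto_const tendsto_eventually)
    qed
  qed (use assms integrable_bounded_mult[OF assms indicator_lessThan_Linf] in \<open>auto simp: indicator_def\<close>)
  then show "(prim f \<circ> u) \<longlonglongrightarrow> prim f a"
    using a u by (simp add: comp_def prim_torus)
qed

text \<open>
  The vanishing of all integrals over intervals extends to \<open>\<integral> f h = 0\<close> for all bounded \<open>h\<close>, and
  \<open>h = sgn f\<close> is such a function.
\<close>

lemma prim_eq_0_imp_AE_0: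
  assumes f: "integrable torus f" and 0: "\<And>y. y \<in> {0..1} \<Longrightarrow> prim f y = 0"
  shows "AE x in torus. f x = 0"
proof -
  have *: "(LINT x|torus. f x * h x) = 0" if "h \<in> Linf_torus" for h
    using that
  proof (induction rule: bounded_measurable_induct)
    case (indicator a b)
    have "(\<lambda>x. f x * indicator {a..<b} x) = (\<lambda>x. f x * indicator {..<b} x - f x * indicator {..<a} x)"
      using indicator by (auto simp: indicator_def)
    then have "(LINT x|torus. f x * indicator {a..<b} x) = prim f b - prim f a"
      using indicator integrable_bounded_mult[OF f indicator_lessThan_Linf] by (simp add: prim_torus)
    then show ?case using indicator 0 by simp
  next
    case (lincomb g k a b)
    have "(\<lambda>x. f x * (a * g x + b * k x)) = (\<lambda>x. a * (f x * g x) + b * (f x * k x))"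
      by (auto simp: algebra_simps)
    then show ?case
      using lincomb integrable_bounded_mult[OF f] by simp
  next
    case (lim h g C)
    have "(\<lambda>n. inner_torus f (h n)) \<longlonglongrightarrow> inner_torus f g"
      by (rule inner_bounded_lim[OF f lim(2-5)])
    then show ?case using lim(1) by (simp add: inner_torus_def LIMSEQ_const_iff)
  qed
  have m: "f \<in> borel_measurable torus" using f by auto
  have "(\<lambda>x. sgn (f x)) \<in> Linf_torus"
    by (rule Linf_torusI[where C = 1]) (use m in \<open>auto simp: sgn_if\<close>)
  from *[OF this] have "(LINT x|torus. \<bar>f x\<bar>) = 0"
    by (simp add: linordered_idom_class.abs_sgn)
  then have "AE x in torus. \<bar>f x\<bar> = 0"
    using integral_nonneg_eq_0_iff_AE[of torus "\<lambda>x. \<bar>f x\<bar>"] f by simp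
  then show ?thesis by simp
qed

section \<open>Integration with respect to the conductance measure\<close>

locale conductance =
  fixes W :: "real \<Rightarrow> real"
  assumes cond: "conductance_function W"
begin

definition mu :: "real measure" where
  "mu = restrict_space (interval_measure W) {0<..1}"

lemma W_strict: "x < y \<Longrightarrow> W x < W y"
  using cond by (auto simp: conductance_function_def strict_mono_def)

lemma W_mono: "x \<le> y \<Longrightarrow> W x \<le> W y"
  using W_strict[of x y] by (cases "x = y") auto

lemma W_0 [simp]: "W 0 = 0"
  using cond by (auto simp: conductance_function_def)

lemma W_rcont: "continuous (at_right u) W"
  using cond by (auto simp: conductance_function_def)

lemma W_measurable [measurable]: "W \<in> borel_measurable borel"
  by (rule borel_measurable_mono) (auto simp: mono_def W_mono)

lemma emeasure_W: "a \<le> b \<Longrightarrow> emeasure (interval_measure W) {a<..b} = W b - W a"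
  by (rule emeasure_interval_measure_Ioc) (auto intro: W_mono W_rcont)

lemma space_mu [simp]: "space mu = {0<..1}"
  by (simp add: mu_def space_restrict_space)

lemma sets_mu: "sets mu = sets (restrict_space borel {0<..1})"
  by (simp add: mu_def sets_restrict_space)

lemma emeasure_mu: "0 \<le> a \<Longrightarrow> a \<le> b \<Longrightarrow> b \<le> 1 \<Longrightarrow> emeasure mu {a<..b} = W b - W a"
  unfolding mu_def by (subst emeasure_restrict_space) (auto simp: emeasure_W)

lemma finite_measure_mu: "finite_measure mu"
proof (rule finite_measureI)
  show "emeasure mu (space mu) \<noteq> \<infinity>"
    using emeasure_mu[of 0 1] by simp
qed

lemma borel_imp_mu_measurable: "h \<in> borel_measurable borel \<Longrightarrow> h \<in> borel_measurable mu"
  unfolding mu_def by (rule measurable_restrict_space1) simp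

lemma continuous_imp_mu_measurable:
  "continuous_on {0<..1} h \<Longrightarrow> h \<in> borel_measurable mu"
  by (subst measurable_cong_sets[OF sets_mu refl]) (rule borel_measurable_continuous_on_restrict)

lemma mu_integrable:
  fixes h :: "real \<Rightarrow> real"
  assumes "h \<in> borel_measurable mu" "\<And>y. y \<in> {0<..1} \<Longrightarrow> \<bar>h y\<bar> \<le> C"
  shows "integrable mu h"
  by (rule finite_measure.integrable_const_bound[OF finite_measure_mu, of _ C])
     (use assms in auto)

text \<open>
  The integral over \<open>(0,x]\<close> is written with the indicator of \<open>y \<le> x\<close> against a fixed finite measure,
  the form that suits Fubini's theorem and dominated convergence.
\<close>

definition stieltjes :: "(real \<Rightarrow> real) \<Rightarrow> real \<Rightarrow> real" where
  "stieltjes p x = (LINT y|mu. p y * indicator {..x} y)"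

lemma stieltjes_eq: "x \<le> 1 \<Longrightarrow> (LINT y:{0<..x}|interval_measure W. p y) = stieltjes p x"
proof -
  assume "x \<le> 1"
  then have *: "indicator {0<..1} y *\<^sub>R (p y * indicator {..x} y) = indicator {0<..x} y *\<^sub>R p y" for y
    by (auto simp: indicator_def)
  have "stieltjes p x
      = (LINT y|interval_measure W. indicator {0<..1} y *\<^sub>R (p y * indicator {..x} y))"
    unfolding stieltjes_def mu_def by (rule integral_restrict_space) simp
  then show ?thesis
    by (simp only: set_lebesgue_integral_def *)
qed

lemma stieltjes_1: "stieltjes p 1 = (LINT y|mu. p y)"
  unfolding stieltjes_def by (rule Bochner_Integration.integral_cong) auto

lemma indicator_atMost_mu [measurable]: "indicator {..x::real} \<in> borel_measurable mu"
  by (rule borel_imp_mu_measurable) simp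

lemma stieltjes_integrable:
  fixes p :: "real \<Rightarrow> real"
  assumes "integrable mu p"
  shows "integrable mu (\<lambda>y. p y * indicator {..x} y)"
proof (rule Bochner_Integration.integrable_bound[OF assms])
  show "(\<lambda>y. p y * indicator {..x} y) \<in> borel_measurable mu"
    using assms by (intro borel_measurable_times indicator_atMost_mu) auto
qed (auto simp: indicator_def)

lemma stieltjes_lincomb:
  assumes "integrable mu p" "integrable mu q"
  shows "stieltjes (\<lambda>y. a * p y + b * q y) x = a * stieltjes p x + b * stieltjes q x"
proof -
  have "(\<lambda>y. (a * p y + b * q y) * indicator {..x} y)
    = (\<lambda>y. a * (p y * indicator {..x} y) + b * (q y * indicator {..x} y))"
    by (auto simp: algebra_simps)
  then show ?thesis
    using stieltjes_integrable[OF assms(1)] stieltjes_integrable[OF assms(2)]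
    by (simp add: stieltjes_def)
qed

lemma stieltjes_const: "0 \<le> x \<Longrightarrow> x \<le> 1 \<Longrightarrow> stieltjes (\<lambda>_. b) x = b * W x"
proof -
  assume x: "0 \<le> x" "x \<le> 1"
  have "stieltjes (\<lambda>_. b) x = (LINT y|mu. b * indicator {0<..x} y)"
    unfolding stieltjes_def by (rule Bochner_Integration.integral_cong) (auto simp: indicator_def)
  also have "\<dots> = b * measure mu {0<..x}"
    using x by (simp add: Int_absorb1 Int_absorb2)
  also have "measure mu {0<..x} = W x"
    using emeasure_mu[of 0 x] x W_mono[of 0 x] by (simp add: measure_def)
  finally show ?thesis .
qed

lemma stieltjes_measurable:
  assumes [measurable]: "p \<in> borel_measurable mu"
  shows "stieltjes p \<in> borel_measurable borel"
proof -
  interpret mu: finite_measure mu by (rule finite_measure_mu)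
  have [measurable]: "(\<lambda>y. y) \<in> borel_measurable mu"
    by (rule borel_imp_mu_measurable) simp
  have "(\<lambda>x. LINT y|mu. p y * (if y \<le> x then 1 else 0)) \<in> borel_measurable borel"
    by (rule mu.borel_measurable_lebesgue_integral) measurable
  moreover have "stieltjes p = (\<lambda>x. LINT y|mu. p y * (if y \<le> x then 1 else 0))"
    by (auto simp: stieltjes_def fun_eq_iff indicator_def of_bool_def intro!: Bochner_Integration.integral_cong)
  ultimately show ?thesis by simp
qed

lemma prim_mu_integrable:
  assumes "integrable torus f"
  shows "integrable mu (prim f)"
proof (rule mu_integrable)
  show "prim f \<in> borel_measurable mu"
    by (rule continuous_imp_mu_measurable, rule continuous_on_subset[OF continuous_on_prim[OF assms]]) auto
qed (use abs_prim_le[OF assms] in auto)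

lemma flux_integrable:
  assumes "integrable torus f"
  shows "integrable mu (\<lambda>y. b + prim f y)"
  by (intro Bochner_Integration.integrable_add prim_mu_integrable assms
      finite_measure.integrable_const[OF finite_measure_mu])

text \<open>
  Integration by parts. The half-open conventions match: the complement of \<open>{x. y \<le> x}\<close> is the set
  \<open>{x. x < y}\<close> over which \<^const>\<open>prim\<close> integrates, so that no boundary term appears at the atoms of
  the conductance measure.
\<close>

lemma torus_mu_Fubini:
  assumes g: "integrable torus g" and p: "p \<in> borel_measurable mu" 
    and bd: "\<And>y. y \<in> {0<..1} \<Longrightarrow> \<bar>p y\<bar> \<le> C"
  shows "(LINT x|torus. g x * stieltjes p x) = (LINT y|mu. p y * ((LINT x|torus. g x) - prim g y))"
proof -
  interpret mu: finite_measure mu by (rule finite_measure_mu)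
  interpret P: pair_sigma_finite torus mu ..
  have gm[measurable]: "g \<in> borel_measurable torus" using g by auto
  note p[measurable]
  have [measurable]: "(\<lambda>y. y) \<in> borel_measurable mu"
    by (rule borel_imp_mu_measurable) simp
  have [measurable]: "(\<lambda>y. y) \<in> borel_measurable torus"
    by (rule borel_imp_torus_measurable) simp
  let ?F = "\<lambda>x y. g x * (p y * (if y \<le> x then 1 else 0))"
  have Fm: "case_prod ?F \<in> borel_measurable (torus \<Otimes>\<^sub>M mu)"
    by measurable
  have pi: "integrable mu p" by (rule mu_integrable[OF p bd])
  have eq1: "(LINT y|mu. ?F x y) = g x * stieltjes p x" for x
    by (auto simp: stieltjes_def indicator_def of_bool_def intro!: Bochner_Integration.integral_cong
        simp flip: integral_mult_right_zero)
  have int: "integrable (torus \<Otimes>\<^sub>M mu) (case_prod ?F)"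
  proof (rule P.Fubini_integrable[OF Fm])
    have bb: "(LINT y|mu. norm (?F x y)) \<le> \<bar>g x\<bar> * (LINT y|mu. \<bar>p y\<bar>)" for x
    proof -
      have "(LINT y|mu. norm (?F x y)) \<le> (LINT y|mu. \<bar>g x\<bar> * \<bar>p y\<bar>)"
      proof (rule integral_mono)
        show "integrable mu (\<lambda>y. norm (?F x y))"
          by (rule Bochner_Integration.integrable_bound[of mu "\<lambda>y. g x * p y"])
             (use pi in \<open>auto simp: abs_mult\<close>)
      qed (use pi in \<open>auto simp: abs_mult\<close>)
      then show ?thesis by simp
    qed
    have m: "(\<lambda>x. LINT y|mu. norm (case_prod ?F (x, y))) \<in> borel_measurable torus"
      by (rule mu.borel_measurable_lebesgue_integral) (use Fm in measurable)
    show "integrable torus (\<lambda>x. LINT y|mu. norm (case_prod ?F (x, y)))"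
    proof (rule Bochner_Integration.integrable_bound[OF _ m])
      show "integrable torus (\<lambda>x. \<bar>g x\<bar> * (LINT y|mu. \<bar>p y\<bar>))" using g by simp
      show "AE x in torus. norm (LINT y|mu. norm (case_prod ?F (x, y))) \<le> norm (\<bar>g x\<bar> * (LINT y|mu. \<bar>p y\<bar>))"
      proof (intro AE_I2)
        fix x
        have "0 \<le> (LINT y|mu. norm (case_prod ?F (x, y)))" by (rule integral_nonneg_AE) auto
        then show "norm (LINT y|mu. norm (case_prod ?F (x, y))) \<le> norm (\<bar>g x\<bar> * (LINT y|mu. \<bar>p y\<bar>))"
          using bb[of x] by simp
      qed
    qed
    show "AE x in torus. integrable mu (\<lambda>y. case_prod ?F (x, y))"
    proof (intro AE_I2)
      fix x
      have "integrable mu (\<lambda>y. p y * (if y \<le> x then 1 else 0))"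
        by (rule Bochner_Integration.integrable_bound[OF pi]) auto
      then show "integrable mu (\<lambda>y. case_prod ?F (x, y))" by simp
    qed
  qed
  have eq2: "(LINT x|torus. ?F x y) = p y * ((LINT x|torus. g x) - prim g y)" if "y \<in> {0<..1}" for y
  proof -
    have "(LINT x|torus. ?F x y) = (LINT x|torus. p y * (g x - g x * indicator {..<y} x))"
      by (rule Bochner_Integration.integral_cong) (auto simp: indicator_def)
    also have "\<dots> = p y * ((LINT x|torus. g x) - prim g y)"
      using that g integrable_bounded_mult[OF g indicator_lessThan_Linf] by (simp add: prim_torus)
    finally show ?thesis .
  qed
  have "(LINT x|torus. g x * stieltjes p x) = (LINT x|torus. LINT y|mu. ?F x y)"
    by (simp only: eq1)
  also have "\<dots> = (LINT y|mu. LINT x|torus. ?F x y)"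
    using P.Fubini_integral[OF int] by simp
  also have "\<dots> = (LINT y|mu. p y * ((LINT x|torus. g x) - prim g y))"
    by (rule Bochner_Integration.integral_cong) (auto simp: eq2)
  finally show ?thesis .
qed

section \<open>The operator and its quadratic form\<close>

lemma stieltjes_flux:
  assumes f: "integrable torus f" and x: "0 \<le> x" "x \<le> 1"
  shows "stieltjes (\<lambda>y. b + prim f y) x = b * W x + stieltjes (prim f) x"
proof -
  have "stieltjes (\<lambda>y. b + prim f y) x = stieltjes (\<lambda>y. 1 * b + 1 * prim f y) x" by simp
  also have "\<dots> = 1 * stieltjes (\<lambda>_. b) x + 1 * stieltjes (prim f) x"
    by (rule stieltjes_lincomb[OF finite_measure.integrable_const[OF finite_measure_mu]
        prim_mu_integrable[OF f]])
  finally show ?thesis using stieltjes_const[OF x] by simp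
qed

text \<open>
  Since \<open>W 0 = 0\<close>, the term \<open>b W(x)\<close> is the Stieltjes integral of the constant \<open>b\<close>. Absorbing it shows
  the domain as the set of \<open>f = c + \<integral> p dW\<close> whose flux \<open>p = b + \<integral>\<ff>\<close> is absolutely continuous; the two
  side conditions say that \<open>p\<close> and \<open>f\<close> are periodic.
\<close>

lemma LW_graph_iff:
  "LW_graph W f \<ff> \<longleftrightarrow>
     f \<in> L2_torus \<and> \<ff> \<in> L2_torus \<and> (LINT z|torus. \<ff> z) = 0 \<and>
     (\<exists>c b. (LINT y|mu. b + prim \<ff> y) = 0 \<and>
        (AE x in torus. f x = c + stieltjes (\<lambda>y. b + prim \<ff> y) x))"
proof -
  have A: "(LINT y:{0<..1}|interval_measure W. b + (LINT z:{0..<y}|lebesgue. \<ff> z))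
      = (LINT y|mu. b + prim \<ff> y)" for b
    using stieltjes_eq[of 1 "\<lambda>y. b + prim \<ff> y"] by (simp add: stieltjes_1 prim_def)
  have B: "(AE x in torus. f x = c + b * W x +
           (LINT y:{0<..x}|interval_measure W. (LINT z:{0..<y}|lebesgue. \<ff> z)))
      \<longleftrightarrow> (AE x in torus. f x = c + stieltjes (\<lambda>y. b + prim \<ff> y) x)"
    if ff: "\<ff> \<in> L2_torus" for b c
  proof (rule AE_cong)
    fix x assume "x \<in> space torus"
    then have x: "0 \<le> x" "x \<le> 1" by auto
    have "stieltjes (\<lambda>y. b + prim \<ff> y) x = b * W x + stieltjes (prim \<ff>) x"
      by (rule stieltjes_flux[OF L2_integrable[OF ff] x])
    moreover have "(LINT y:{0<..x}|interval_measure W. (LINT z:{0..<y}|lebesgue. \<ff> z)) = stieltjes (prim \<ff>) x"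
      using stieltjes_eq[OF x(2), of "prim \<ff>"] by (simp add: prim_def[abs_def])
    ultimately show "(f x = c + b * W x + (LINT y:{0<..x}|interval_measure W. (LINT z:{0..<y}|lebesgue. \<ff> z)))
        \<longleftrightarrow> (f x = c + stieltjes (\<lambda>y. b + prim \<ff> y) x)"
      by (simp add: add.assoc)
  qed
  show ?thesis
    by (cases "\<ff> \<in> L2_torus") (simp_all only: LW_graph_def A B simp_thms)
qed

lemma LW_graph_L2:
  assumes "LW_graph W f \<ff>" shows "f \<in> L2_torus" "\<ff> \<in> L2_torus"
  using assms by (auto simp: LW_graph_iff)

lemma flux_measurable:
  assumes "integrable torus f" shows "(\<lambda>y. b + prim f y) \<in> borel_measurable mu"
  using flux_integrable[OF assms] by auto

lemma flux_bound:
  assumes "integrable torus f" "y \<le> 1"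
  shows "\<bar>b + prim f y\<bar> \<le> \<bar>b\<bar> + (LINT z|torus. \<bar>f z\<bar>)"
  using abs_prim_le[OF assms] by linarith

lemma flux_mult_integrable:
  assumes "integrable torus f" "integrable torus g"
  shows "integrable mu (\<lambda>y. (b + prim f y) * (c + prim g y))"
proof (rule mu_integrable)
  show "(\<lambda>y. (b + prim f y) * (c + prim g y)) \<in> borel_measurable mu"
    by (intro borel_measurable_times flux_measurable assms)
  fix y :: real assume "y \<in> {0<..1}"
  then have y: "y \<le> 1" by simp
  show "\<bar>(b + prim f y) * (c + prim g y)\<bar>
      \<le> (\<bar>b\<bar> + (LINT z|torus. \<bar>f z\<bar>)) * (\<bar>c\<bar> + (LINT z|torus. \<bar>g z\<bar>))"
    unfolding abs_mult
    by (intro mult_mono flux_bound assms y add_nonneg_nonneg integral_nonneg_AE) auto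
qed

text \<open>
  The identity \<open>\<langle>g, f\<rangle> = - \<integral> p\<^sub>f p\<^sub>g dW\<close> for \<open>g\<close> of mean zero. The constant \<open>d\<close> in the primitive of \<open>g\<close> is
  arbitrary because \<open>p\<^sub>f\<close> has integral zero; it is there so that the right-hand side becomes
  symmetric when \<open>g\<close> is itself the image of a function in the domain.
\<close>

lemma inner_LW_graph:
  assumes g: "integrable torus g" "(LINT z|torus. g z) = 0"
    and ff: "integrable torus \<ff>" "(LINT y|mu. b + prim \<ff> y) = 0"
    and f: "AE x in torus. f x = c + stieltjes (\<lambda>y. b + prim \<ff> y) x" "f \<in> borel_measurable torus"
  shows "inner_torus g f = - (LINT y|mu. (b + prim \<ff> y) * (d + prim g y))"
proof -
  let ?p = "\<lambda>y. b + prim \<ff> y"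
  have sm: "stieltjes ?p \<in> borel_measurable torus"
    by (intro borel_imp_torus_measurable stieltjes_measurable flux_measurable ff)
  have "stieltjes ?p \<in> Linf_torus"
  proof (rule Linf_torusI[OF sm])
    fix x :: real
    have "\<bar>stieltjes ?p x\<bar> \<le> (LINT y|mu. \<bar>?p y * indicator {..x} y\<bar>)"
      unfolding stieltjes_def by (rule integral_abs_bound)
    also have "\<dots> \<le> (LINT y|mu. \<bar>?p y\<bar>)"
      using flux_integrable[OF ff(1), of b] stieltjes_integrable[OF flux_integrable[OF ff(1), of b]]
      by (intro integral_mono integrable_abs) (auto simp: indicator_def)
    finally show "\<bar>stieltjes ?p x\<bar> \<le> (LINT y|mu. \<bar>?p y\<bar>)" .
  qed
  note i = integrable_bounded_mult[OF g(1) this]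
  have "inner_torus g f = (LINT x|torus. c * g x + g x * stieltjes ?p x)"
    unfolding inner_torus_def
  proof (rule integral_cong_AE)
    show "(\<lambda>x. g x * f x) \<in> borel_measurable torus" using g f by (intro borel_measurable_times) auto
    show "(\<lambda>x. c * g x + g x * stieltjes ?p x) \<in> borel_measurable torus"
      using g(1) i by auto
    show "AE x in torus. g x * f x = c * g x + g x * stieltjes ?p x"
      using f(1) by eventually_elim (simp add: algebra_simps)
  qed
  also have "\<dots> = (LINT x|torus. g x * stieltjes ?p x)"
    using g i by simp
  also have "\<dots> = (LINT y|mu. ?p y * ((LINT x|torus. g x) - prim g y))"
    by (rule torus_mu_Fubini[OF g(1) flux_measurable[OF ff(1)] flux_bound[OF ff(1)]]) simp
  also have "\<dots> = (LINT y|mu. d * ?p y - ?p y * (d + prim g y))"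
    by (rule Bochner_Integration.integral_cong) (auto simp: g algebra_simps)
  also have "\<dots> = d * (LINT y|mu. ?p y) - (LINT y|mu. ?p y * (d + prim g y))"
    using flux_integrable[OF ff(1), of b] flux_mult_integrable[OF ff(1) g(1), of b d]
    by (subst Bochner_Integration.integral_diff) auto
  finally show ?thesis using ff(2) by simp
qed

lemma LW_graph_sym:
  assumes "LW_graph W f \<ff>" "LW_graph W g \<gg>"
  shows "inner_torus \<gg> f = inner_torus \<ff> g"
proof -
  obtain c b where cb: "(LINT y|mu. b + prim \<ff> y) = 0"
      "AE x in torus. f x = c + stieltjes (\<lambda>y. b + prim \<ff> y) x"
    and f: "f \<in> borel_measurable torus" "integrable torus \<ff>" "(LINT z|torus. \<ff> z) = 0"
    using assms(1) L2_integrable L2_torus_measurable unfolding LW_graph_iff by blast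
  obtain c' b' where cb': "(LINT y|mu. b' + prim \<gg> y) = 0"
      "AE x in torus. g x = c' + stieltjes (\<lambda>y. b' + prim \<gg> y) x"
    and g: "g \<in> borel_measurable torus" "integrable torus \<gg>" "(LINT z|torus. \<gg> z) = 0"
    using assms(2) L2_integrable L2_torus_measurable unfolding LW_graph_iff by blast
  show ?thesis
    using inner_LW_graph[OF g(2,3) f(2) cb f(1), of b'] inner_LW_graph[OF f(2,3) g(2) cb' g(1), of b]
    by (simp add: mult.commute)
qed

lemma LW_graph_nonpos:
  assumes "LW_graph W f \<ff>"
  shows "inner_torus \<ff> f \<le> 0"
proof -
  obtain c b where cb: "(LINT y|mu. b + prim \<ff> y) = 0"
      "AE x in torus. f x = c + stieltjes (\<lambda>y. b + prim \<ff> y) x"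
    and f: "f \<in> borel_measurable torus" "integrable torus \<ff>" "(LINT z|torus. \<ff> z) = 0"
    using assms(1) L2_integrable L2_torus_measurable unfolding LW_graph_iff by blast
  show ?thesis
    using inner_LW_graph[OF f(2,3) f(2) cb f(1), of b] by simp
qed

lemma LW_graph_lincomb:
  assumes "LW_graph W f \<ff>" "LW_graph W g \<gg>"
  shows "LW_graph W (\<lambda>x. s * f x + t * g x) (\<lambda>x. s * \<ff> x + t * \<gg> x)"
proof -
  obtain c b where cb: "(LINT y|mu. b + prim \<ff> y) = 0"
      "AE x in torus. f x = c + stieltjes (\<lambda>y. b + prim \<ff> y) x"
    and f: "f \<in> L2_torus" "\<ff> \<in> L2_torus" "(LINT z|torus. \<ff> z) = 0"
    using assms(1) unfolding LW_graph_iff by blast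
  obtain c' b' where cb': "(LINT y|mu. b' + prim \<gg> y) = 0"
      "AE x in torus. g x = c' + stieltjes (\<lambda>y. b' + prim \<gg> y) x"
    and g: "g \<in> L2_torus" "\<gg> \<in> L2_torus" "(LINT z|torus. \<gg> z) = 0"
    using assms(2) unfolding LW_graph_iff by blast
  let ?p = "\<lambda>y. b + prim \<ff> y" and ?q = "\<lambda>y. b' + prim \<gg> y"
  let ?r = "\<lambda>y. (s * b + t * b') + prim (\<lambda>x. s * \<ff> x + t * \<gg> x) y"
  have r: "?r y = s * ?p y + t * ?q y" if "y \<in> space mu" for y
    using that prim_lincomb[OF L2_integrable[OF f(2)] L2_integrable[OF g(2)], of y s t]
    by (simp add: algebra_simps)
  note pi = flux_integrable[OF L2_integrable[OF f(2)], of b]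
  note qi = flux_integrable[OF L2_integrable[OF g(2)], of b']
  have "(LINT y|mu. ?r y) = (LINT y|mu. s * ?p y + t * ?q y)"
    by (rule Bochner_Integration.integral_cong[OF refl r])
  also have "\<dots> = s * (LINT y|mu. ?p y) + t * (LINT y|mu. ?q y)"
    using pi qi by (subst Bochner_Integration.integral_add) auto
  finally have 1: "(LINT y|mu. ?r y) = 0" using cb(1) cb'(1) by simp
  have "stieltjes ?r x = stieltjes (\<lambda>y. s * ?p y + t * ?q y) x" for x
    unfolding stieltjes_def by (rule Bochner_Integration.integral_cong) (use r in auto)
  then have 2: "stieltjes ?r x = s * stieltjes ?p x + t * stieltjes ?q x" for x
    using stieltjes_lincomb[OF pi qi] by simp
  have "AE x in torus. s * f x + t * g x = (s * c + t * c') + (s * stieltjes ?p x + t * stieltjes ?q x)"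
    using cb(2) cb'(2) by eventually_elim (simp add: algebra_simps)
  then have "AE x in torus. s * f x + t * g x = (s * c + t * c') + stieltjes ?r x"
    by (simp only: 2)
  moreover have "(LINT x|torus. s * \<ff> x + t * \<gg> x) = 0"
    using f g L2_integrable[OF f(2)] L2_integrable[OF g(2)] by simp
  ultimately show ?thesis
    unfolding LW_graph_iff using 1 f g by (blast intro: L2_lincomb)
qed

text \<open>
  As \<open>W\<close> is strictly increasing, the conductance measure charges every interval.
\<close>

lemma continuous_AE_mu_0:
  assumes p: "continuous_on {0..1} p" and ae: "AE y in mu. p y = (0::real)" and y: "y \<in> {0..1}"
  shows "p y = 0"
proof (rule ccontr)
  assume ne: "p y \<noteq> 0"
  obtain d where d: "d > 0" "\<And>z. z \<in> {0..1} \<Longrightarrow> dist z y < d \<Longrightarrow> p z \<noteq> 0"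
  proof -
    obtain d where "d > 0" "\<forall>z\<in>{0..1}. dist z y < d \<longrightarrow> dist (p z) (p y) < \<bar>p y\<bar>"
      using p y ne unfolding continuous_on_iff by (metis zero_less_abs_iff)
    then show ?thesis using that[of d] by (fastforce simp: dist_real_def)
  qed
  define a where "a = max 0 (y - d / 2)"
  define e where "e = min 1 (y + d / 2)"
  have ae': "0 \<le> a" "a < e" "e \<le> 1" using d(1) y by (auto simp: a_def e_def)
  have nz: "p z \<noteq> 0" if "z \<in> {a<..e}" for z
    using that ae' d(1) by (intro d(2)) (auto simp: dist_real_def a_def e_def)
  have "emeasure mu {a<..e} > 0"
    using emeasure_mu[of a e] ae' W_strict[of a e] by simp
  moreover have "AE z in mu. z \<notin> {a<..e}"
    using ae by eventually_elim (use nz in auto)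
  moreover have "{a<..e} \<in> sets mu"
    unfolding sets_mu using ae' by (auto simp: sets_restrict_space_iff)
  ultimately show False
    by (metis AE_iff_null_sets null_setsD1 less_irrefl)
qed

text \<open>
  If \<open>f = 0\<close> then \<open>\<integral> p\<^sup>2 dW = - \<langle>\<ff>, f\<rangle> = 0\<close>, hence \<open>p\<close> vanishes identically and so does its density \<open>\<ff>\<close>.
\<close>

lemma LW_graph_unique:
  assumes "LW_graph W f \<ff>" "AE x in torus. f x = 0"
  shows "AE x in torus. \<ff> x = 0"
proof -
  obtain c b where cb: "(LINT y|mu. b + prim \<ff> y) = 0"
      "AE x in torus. f x = c + stieltjes (\<lambda>y. b + prim \<ff> y) x"
    and f: "f \<in> borel_measurable torus" "integrable torus \<ff>" "(LINT z|torus. \<ff> z) = 0"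
    using assms(1) L2_integrable L2_torus_measurable unfolding LW_graph_iff by blast
  let ?p = "\<lambda>y. b + prim \<ff> y"
  have "inner_torus \<ff> f = inner_torus \<ff> (\<lambda>_. 0)"
    using assms(2) f by (intro inner_cong_AE) auto
  then have "(LINT y|mu. ?p y * ?p y) = 0"
    using inner_LW_graph[OF f(2,3) f(2) cb f(1), of b] by (simp add: inner_torus_def)
  then have "AE y in mu. ?p y * ?p y = 0"
    using integral_nonneg_eq_0_iff_AE[OF flux_mult_integrable[OF f(2) f(2), of b b]] by simp
  then have ae: "AE y in mu. ?p y = 0" by simp
  have cont: "continuous_on {0..1} ?p"
    by (intro continuous_intros continuous_on_subset[OF continuous_on_prim[OF f(2)]]) auto
  have p0: "?p y = 0" if "y \<in> {0..1}" for y
    using continuous_AE_mu_0[OF cont ae that] .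
  have "b = 0" using p0[of 0] by simp
  then have "prim \<ff> y = 0" if "y \<in> {0..1}" for y using p0[OF that] by simp
  then show ?thesis by (rule prim_eq_0_imp_AE_0[OF f(2)])
qed

section \<open>The resolvent equation as a Volterra equation\<close>

definition dprim :: "(real \<Rightarrow> real) \<Rightarrow> real \<Rightarrow> real" where
  "dprim h x = stieltjes (prim h) x"

lemma dprim_measurable: "integrable torus h \<Longrightarrow> dprim h \<in> borel_measurable borel"
  unfolding dprim_def[abs_def] using stieltjes_measurable prim_mu_integrable by auto

lemma dprim_lincomb:
  assumes "integrable torus f" "integrable torus g"
  shows "dprim (\<lambda>x. a * f x + b * g x) x = a * dprim f x + b * dprim g x"
proof -
  have "dprim (\<lambda>x. a * f x + b * g x) x = stieltjes (\<lambda>y. a * prim f y + b * prim g y) x"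
    unfolding dprim_def stieltjes_def
    by (rule Bochner_Integration.integral_cong) (auto simp: prim_lincomb[OF assms])
  then show ?thesis
    using stieltjes_lincomb[OF prim_mu_integrable[OF assms(1)] prim_mu_integrable[OF assms(2)]]
    by (simp add: dprim_def)
qed

lemma integral_exp_torus:
  assumes "M > 0" "y \<in> {0..1}"
  shows "(LINT z|torus. exp (M * z) * indicator {..<y} z) \<le> exp (M * y) / M"
proof -
  have "(LINT z|torus. exp (M * z) * indicator {..<y} z) = prim (\<lambda>z. exp (M * z)) y"
    using assms by (simp add: prim_torus)
  also have "\<dots> = (LINT z:{0..y}|lebesgue. exp (M * z))"
  proof -
    have m: "(\<lambda>z. indicator A z *\<^sub>R exp (M * z)) \<in> borel_measurable lebesgue"
      if "A \<in> sets borel" for A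
      using that by (intro measurable_completion) (simp, measurable)
    have "AE z in lebesgue. z \<noteq> y"
      by (rule AE_completion) (rule AE_lborel_singleton)
    then have "AE z in lebesgue. indicator {0..<y} z *\<^sub>R exp (M * z) = indicator {0..y} z *\<^sub>R exp (M * z)"
      by eventually_elim (auto simp: indicator_def)
    then show ?thesis
      unfolding prim_def set_lebesgue_integral_def
      by (intro integral_cong_AE m) auto
  qed
  also have "\<dots> = (exp (M * y) - 1) / M"
  proof -
    have "((\<lambda>z. exp (M * z)) has_integral exp (M * y) / M - exp (M * 0) / M) {0..y}"
      using assms by (intro fundamental_theorem_of_calculus)
        (auto intro!: derivative_eq_intros simp flip: has_real_derivative_iff_has_vector_derivative)
    moreover have "set_integrable lebesgue {0..y} (\<lambda>z. exp (M * z))"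
      by (intro absolutely_integrable_continuous_real continuous_intros)
    ultimately show ?thesis
      by (simp add: set_lebesgue_integral_eq_integral(2) integral_unique diff_divide_distrib)
  qed
  also have "\<dots> \<le> exp (M * y) / M"
    using assms by (simp add: divide_right_mono)
  finally show ?thesis .
qed

text \<open>
  In the norm \<open>sup \<bar>h(x)\<bar> exp(- M x)\<close> the double primitive has norm at most \<open>W(1)/M\<close>: the inner
  integral gains the factor \<open>1/M\<close>, the outer one costs the total mass.
\<close>

lemma dprim_exp_bound:
  assumes h: "h \<in> borel_measurable torus" and bd: "\<And>z. z \<in> {0..<1} \<Longrightarrow> \<bar>h z\<bar> \<le> C * exp (M * z)"
    and M: "M > 0" and C: "C \<ge> 0" and x: "x \<in> {0..1}"
  shows "\<bar>dprim h x\<bar> \<le> W 1 / M * C * exp (M * x)"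
proof -
  have hL: "h \<in> Linf_torus"
  proof (rule Linf_torusI[OF h])
    fix z :: real assume z: "z \<in> {0..<1}"
    have "\<bar>h z\<bar> \<le> C * exp (M * z)" by (rule bd[OF z])
    also have "\<dots> \<le> C * exp M" using z M C by (intro mult_left_mono) auto
    finally show "\<bar>h z\<bar> \<le> C * exp M" .
  qed
  note hi = Linf_torus_integrable[OF hL]
  have eL: "(\<lambda>z. exp (M * z)) \<in> Linf_torus"
    by (rule Linf_torusI[where C = "exp M"])
       (use M in \<open>auto intro!: borel_imp_torus_measurable\<close>)
  have p: "\<bar>prim h y\<bar> \<le> C * (exp (M * y) / M)" if y: "y \<in> {0..1}" for y
  proof -
    have y1: "y \<le> 1" using y by simp
    have "\<bar>prim h y\<bar> \<le> (LINT z|torus. \<bar>h z * indicator {..<y} z\<bar>)"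
      unfolding prim_torus[OF y1] by (rule integral_abs_bound)
    also have "\<dots> \<le> (LINT z|torus. C * (exp (M * z) * indicator {..<y} z))"
    proof (rule integral_mono)
      show "integrable torus (\<lambda>z. \<bar>h z * indicator {..<y} z\<bar>)"
        using integrable_bounded_mult[OF hi indicator_lessThan_Linf] by auto
      show "integrable torus (\<lambda>z. C * (exp (M * z) * indicator {..<y} z))"
        using integrable_bounded_mult[OF Linf_torus_integrable[OF eL] indicator_lessThan_Linf] by auto
      show "\<bar>h z * indicator {..<y} z\<bar> \<le> C * (exp (M * z) * indicator {..<y} z)"
        if "z \<in> space torus" for z
      proof -
        have "\<bar>h z\<bar> \<le> C * exp (M * z)" by (rule bd) (use that in simp)
        then show ?thesis by (simp add: indicator_def)
      qed
    qed
    also have "\<dots> = C * (LINT z|torus. exp (M * z) * indicator {..<y} z)"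
      by simp
    also have "\<dots> \<le> C * (exp (M * y) / M)"
      by (rule mult_left_mono[OF integral_exp_torus[OF M y] C])
    finally show ?thesis .
  qed
  have "\<bar>dprim h x\<bar> \<le> (LINT y|mu. \<bar>prim h y * indicator {..x} y\<bar>)"
    unfolding dprim_def stieltjes_def by (rule integral_abs_bound)
  also have "\<dots> \<le> (LINT y|mu. C * (exp (M * x) / M))"
  proof (rule integral_mono)
    show "integrable mu (\<lambda>y. \<bar>prim h y * indicator {..x} y\<bar>)"
      using stieltjes_integrable[OF prim_mu_integrable[OF hi]] by auto
    show "integrable mu (\<lambda>y. C * (exp (M * x) / M))"
      by (rule finite_measure.integrable_const[OF finite_measure_mu])
    fix y assume "y \<in> space mu"
    then have y: "y \<in> {0..1}" by simp
    show "\<bar>prim h y * indicator {..x} y\<bar> \<le> C * (exp (M * x) / M)"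
    proof (cases "y \<le> x")
      case True
      have "\<bar>prim h y\<bar> \<le> C * (exp (M * y) / M)" by (rule p[OF y])
      also have "\<dots> \<le> C * (exp (M * x) / M)"
        using True M C by (intro mult_left_mono divide_right_mono) auto
      finally show ?thesis using True by simp
    next
      case False then show ?thesis using M C by simp
    qed
  qed
  also have "\<dots> = W 1 / M * C * exp (M * x)"
    using emeasure_mu[of 0 1] W_mono[of 0 1] by (simp add: measure_def)
  finally show ?thesis .
qed

text \<open>
  Picard iteration, a contraction by \<open>1/2\<close> in the exponentially weighted supremum norm for
  \<open>M \<ge> 2 lam W(1)\<close>.
\<close>

lemma volterra_exists:
  assumes F: "F \<in> Linf_torus" and lam: "lam \<ge> 0"
  shows "\<exists>g\<in>Linf_torus. \<forall>x\<in>{0..<1}. g x = F x + lam * dprim g x"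
proof -
  \<comment> \<open>any \<open>M > 0\<close> with \<open>M \<ge> 2 lam W(1)\<close>; the summand 1 covers \<open>lam = 0\<close>\<close>
  define M where "M = 2 * lam * W 1 + 1"
  have W1: "W 1 \<ge> 0" using W_mono[of 0 1] by simp
  have M: "M > 0" "lam * (W 1 / M) \<le> 1 / 2"
  proof -
    show "M > 0" unfolding M_def using lam W1 by (simp add: add_nonneg_pos)
    then show "lam * (W 1 / M) \<le> 1 / 2" by (simp add: M_def field_simps)
  qed
  obtain C where C: "C \<ge> 0" "\<And>x. x \<in> {0..<1} \<Longrightarrow> \<bar>F x\<bar> \<le> C"
    using Linf_torus_bound[OF F] by blast
  define T where "T n = ((\<lambda>h x. lam * dprim h x) ^^ n) F" for n
  have T0: "T 0 = F" and TS: "T (Suc n) = (\<lambda>x. lam * dprim (T n) x)" for n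
    by (auto simp: T_def)
  have TL: "T n \<in> borel_measurable torus \<and> (\<forall>x\<in>{0..<1}. \<bar>T n x\<bar> \<le> (C * (1/2)^n) * exp (M * x))" for n
  proof (induction n)
    case 0
    have "\<bar>F x\<bar> \<le> C * exp (M * x)" if "x \<in> {0..<1}" for x
    proof -
      have "1 \<le> exp (M * x)" using that M(1) by simp
      from mult_left_mono[OF this C(1)] C(2)[OF that] show ?thesis by simp
    qed
    then show ?case using Linf_torus_measurable[OF F] by (simp add: T0)
  next
    case (Suc n)
    have bd: "\<And>x. x \<in> {0..<1} \<Longrightarrow> \<bar>T n x\<bar> \<le> (C * (1/2)^n) * exp (M * x)" using Suc by blast
    have L: "T n \<in> Linf_torus"
    proof (rule Linf_torusI)
      show "T n \<in> borel_measurable torus" using Suc by blast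
      fix x :: real assume x: "x \<in> {0..<1}"
      show "\<bar>T n x\<bar> \<le> (C * (1/2)^n) * exp M"
        by (rule order_trans[OF bd[OF x]], intro mult_left_mono) (use x M C in auto)
    qed
    have m: "T (Suc n) \<in> borel_measurable torus"
      unfolding TS using dprim_measurable[OF Linf_torus_integrable[OF L]]
      by (intro borel_imp_torus_measurable borel_measurable_times) auto
    moreover have "\<bar>T (Suc n) x\<bar> \<le> (C * (1/2)^(Suc n)) * exp (M * x)" if x: "x \<in> {0..<1}" for x
    proof -
      have "\<bar>dprim (T n) x\<bar> \<le> W 1 / M * (C * (1/2)^n) * exp (M * x)"
        by (rule dprim_exp_bound[OF Linf_torus_measurable[OF L] bd M(1)]) (use x C in auto)
      then have "lam * \<bar>dprim (T n) x\<bar> \<le> lam * (W 1 / M * (C * (1/2)^n) * exp (M * x))"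
        by (rule mult_left_mono[OF _ lam])
      also have "\<dots> = (lam * (W 1 / M)) * ((C * (1/2)^n) * exp (M * x))"
        by simp
      also have "\<dots> \<le> 1 / 2 * ((C * (1/2)^n) * exp (M * x))"
        by (rule mult_right_mono[OF M(2)]) (use C in auto)
      finally show ?thesis using lam by (simp add: TS abs_mult)
    qed
    ultimately show ?case by blast
  qed
  have Tbd: "\<bar>T n x\<bar> \<le> (C * exp M) * (1/2)^n" if x: "x \<in> {0..<1}" for n x
  proof -
    have "\<bar>T n x\<bar> \<le> (C * (1/2)^n) * exp (M * x)" using TL x by blast
    also have "\<dots> \<le> (C * (1/2)^n) * exp M" by (intro mult_left_mono) (use x M C in auto)
    finally show ?thesis by (simp add: mult.commute mult.left_commute)
  qed
  define K where "K = C * exp M"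
  have K: "K \<ge> 0" using C by (simp add: K_def)
  have TLi: "T n \<in> Linf_torus" for n
    by (rule Linf_torusI[where C = "K * (1/2)^n"]) (use TL Tbd in \<open>auto simp: K_def\<close>)
  define S where "S n x = (\<Sum>i<n. T i x)" for n x
  define g where "g x = (\<Sum>i. T i x)" for x
  have sm: "summable (\<lambda>n. K * (1/2)^n :: real)"
    by (intro summable_mult summable_geometric) simp
  have ul: "uniform_limit {0..<1} S g sequentially"
    unfolding S_def[abs_def] g_def[abs_def]
    by (rule Weierstrass_m_test[OF _ sm]) (use Tbd in \<open>auto simp: K_def\<close>)
  have lim: "(\<lambda>n. S n x) \<longlonglongrightarrow> g x" if "x \<in> {0..<1}" for x
    using tendsto_uniform_limitI[OF ul that] .
  have Sm: "S n \<in> borel_measurable torus" for n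
    unfolding S_def[abs_def] using TL by (intro borel_measurable_sum) auto
  have gm: "g \<in> borel_measurable torus"
    by (rule borel_measurable_LIMSEQ_real[where u = S]) (use lim Sm in auto)
  have Sbd: "\<bar>S n x\<bar> \<le> 2 * K" if "x \<in> {0..<1}" for n x
  proof -
    have "\<bar>S n x\<bar> \<le> (\<Sum>i<n. \<bar>T i x\<bar>)" unfolding S_def by (rule sum_abs)
    also have "\<dots> \<le> (\<Sum>i<n. K * (1/2)^i)" by (intro sum_mono) (use Tbd that in \<open>auto simp: K_def\<close>)
    also have "\<dots> \<le> (\<Sum>i. K * (1/2)^i)" by (rule sum_le_suminf[OF sm]) (use K in auto)
    also have "\<dots> = 2 * K" using suminf_mult[OF summable_geometric, of "1/2::real" K] suminf_geometric[of "1/2::real"] by simp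
    finally show ?thesis .
  qed
  have SL: "S n \<in> Linf_torus" for n by (rule Linf_torusI[OF Sm Sbd])
  have gL: "g \<in> Linf_torus"
  proof (rule Linf_torusI[OF gm])
    fix x :: real assume x: "x \<in> {0..<1}"
    show "\<bar>g x\<bar> \<le> 2 * K"
      by (rule LIMSEQ_le_const2[OF tendsto_rabs[OF lim[OF x]]]) (use Sbd[OF x] in auto)
  qed
  have rec: "S (Suc n) x = F x + lam * dprim (S n) x" for n x
  proof (induction n)
    case 0
    have "dprim (\<lambda>_. 0) x = 0"
      using dprim_lincomb[OF Linf_torus_integrable[OF F] Linf_torus_integrable[OF F], of 0 0 x]
      by simp
    then show ?case by (simp add: S_def[abs_def] T0)
  next
    case (Suc n)
    have "dprim (S (Suc n)) x = dprim (\<lambda>z. 1 * S n z + 1 * T n z) x"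
      by (simp add: S_def[abs_def])
    also have "\<dots> = dprim (S n) x + dprim (T n) x"
      using dprim_lincomb[OF Linf_torus_integrable[OF SL[of n]] Linf_torus_integrable[OF TLi[of n]], of 1 1 x]
      by simp
    finally have "F x + lam * dprim (S (Suc n)) x = S (Suc n) x + T (Suc n) x"
      using Suc by (simp add: TS algebra_simps)
    moreover have "S (Suc (Suc n)) x = S (Suc n) x + T (Suc n) x" by (simp add: S_def)
    ultimately show ?case by linarith
  qed
  have plim: "(\<lambda>n. prim (S n) y) \<longlonglongrightarrow> prim g y" if y: "y \<le> 1" for y
  proof -
    have "(\<lambda>n. inner_torus (indicator {..<y}) (S n)) \<longlonglongrightarrow> inner_torus (indicator {..<y}) g"
      by (rule inner_bounded_lim[OF Linf_torus_integrable[OF indicator_lessThan_Linf] Sm gL Sbd])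
         (use lim in auto)
    then show ?thesis using y by (simp add: prim_torus inner_torus_def mult.commute)
  qed
  have dlim: "(\<lambda>n. dprim (S n) x) \<longlonglongrightarrow> dprim g x" for x
    unfolding dprim_def stieltjes_def
  proof (rule integral_dominated_convergence[where w = "\<lambda>_. 2 * K"])
    show "integrable mu (\<lambda>_. 2 * K)"
      by (rule finite_measure.integrable_const[OF finite_measure_mu])
    show "AE y in mu. (\<lambda>n. prim (S n) y * indicator {..x} y) \<longlonglongrightarrow> prim g y * indicator {..x} y"
      by (intro AE_I2 tendsto_mult plim tendsto_const) simp
    show "(\<lambda>y. prim g y * indicator {..x} y) \<in> borel_measurable mu"
      using stieltjes_integrable[OF prim_mu_integrable[OF Linf_torus_integrable[OF gL]]] by auto
    show "(\<lambda>y. prim (S n) y * indicator {..x} y) \<in> borel_measurable mu" for n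
      using stieltjes_integrable[OF prim_mu_integrable[OF Linf_torus_integrable[OF SL]]] by auto
    show "AE y in mu. norm (prim (S n) y * indicator {..x} y) \<le> 2 * K" for n
    proof (intro AE_I2)
      fix y assume "y \<in> space mu"
      then have y: "y \<le> 1" by simp
      have "\<bar>prim (S n) y\<bar> \<le> (LINT z|torus. \<bar>S n z\<bar>)"
        by (rule abs_prim_le[OF Linf_torus_integrable[OF SL] y])
      also have "\<dots> \<le> (LINT z|torus. 2 * K)"
        by (rule integral_mono) (use Linf_torus_integrable[OF SL[of n]] Sbd in auto)
      also have "\<dots> = 2 * K" by (simp add: measure_restrict_space)
      finally show "norm (prim (S n) y * indicator {..x} y) \<le> 2 * K"
        using K by (auto simp: indicator_def)
    qed
  qed
  have "g x = F x + lam * dprim g x" if x: "x \<in> {0..<1}" for x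
  proof (rule LIMSEQ_unique)
    show "(\<lambda>n. S (Suc n) x) \<longlonglongrightarrow> g x" using LIMSEQ_Suc[OF lim[OF x]] .
    show "(\<lambda>n. S (Suc n) x) \<longlonglongrightarrow> F x + lam * dprim g x"
      unfolding rec by (intro tendsto_intros dlim)
  qed
  then show ?thesis using gL by blast
qed

end

lemma AE_torus_ex:
  assumes P: "AE x in torus. P x" and ab: "0 \<le> a" "a < b" "b \<le> (1::real)"
  shows "\<exists>x\<in>{a<..<b}. P x"
proof (rule ccontr)
  assume "\<not> ?thesis"
  then have "AE x in torus. x \<notin> {a<..<b}"
    using P by (auto elim!: eventually_mono)
  then have "{a<..<b} \<in> null_sets torus"
    using ab by (subst AE_iff_null_sets) (auto simp: sets_restrict_space_iff)
  then have "emeasure torus {a<..<b} = 0" by (rule null_setsD1)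
  moreover have "emeasure torus {a<..<b} = emeasure lebesgue {a<..<b}"
    using ab by (intro emeasure_restrict_space) auto
  ultimately show False using ab by simp
qed

context conductance begin

lemma LW_graphI:
  assumes f: "f \<in> L2_torus" and ff: "\<ff> \<in> L2_torus" "(LINT z|torus. \<ff> z) = 0"
    and b: "b * W 1 + dprim \<ff> 1 = 0"
    and ae: "AE x in torus. f x = c + b * W x + dprim \<ff> x"
  shows "LW_graph W f \<ff>"
  unfolding LW_graph_iff
proof (intro conjI exI f ff)
  note i = L2_integrable[OF ff(1)]
  show "(LINT y|mu. b + prim \<ff> y) = 0"
    using stieltjes_flux[OF i, of 1 b] b by (simp add: stieltjes_1 dprim_def)
  have "AE x in torus. x \<in> {0..<1}" by (rule AE_I2) simp
  then show "AE x in torus. f x = c + stieltjes (\<lambda>y. b + prim \<ff> y) x"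
    using ae by eventually_elim (simp add: stieltjes_flux[OF i] dprim_def)
qed

lemma dprim_Linf: 
  assumes "integrable torus h"
  shows "dprim h \<in> Linf_torus"
proof (rule Linf_torusI)
  show "dprim h \<in> borel_measurable torus"
    by (rule borel_imp_torus_measurable[OF dprim_measurable[OF assms]])
  fix x
  have "\<bar>dprim h x\<bar> \<le> (LINT y|mu. \<bar>prim h y * indicator {..x} y\<bar>)"
    unfolding dprim_def stieltjes_def by (rule integral_abs_bound)
  also have "\<dots> \<le> (LINT y|mu. \<bar>prim h y\<bar>)"
    using prim_mu_integrable[OF assms] stieltjes_integrable[OF prim_mu_integrable[OF assms]]
    by (intro integral_mono integrable_abs) (auto simp: indicator_def)
  finally show "\<bar>dprim h x\<bar> \<le> (LINT y|mu. \<bar>prim h y\<bar>)" .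
qed

lemma W_Linf: "W \<in> Linf_torus"
proof (rule Linf_torusI)
  show "W \<in> borel_measurable torus" by (rule borel_imp_torus_measurable) simp
  show "\<bar>W x\<bar> \<le> W 1" if "x \<in> {0..<1}" for x
    using that W_mono[of 0 x] W_mono[of x 1] by simp
qed

lemma dprim_cong_AE_0:
  assumes "AE x in torus. h x = 0" "h \<in> borel_measurable torus"
  shows "dprim h x = 0"
proof -
  have "prim h y = prim (\<lambda>_. 0) y" if "y \<le> 1" for y
    by (rule prim_cong_AE[OF _ assms(2) _ that]) (use assms in auto)
  then have "prim h y = 0" if "y \<le> 1" for y using that by (simp add: prim_def set_lebesgue_integral_def)
  then have "dprim h x = (LINT y|mu. 0)"
    unfolding dprim_def stieltjes_def by (intro Bochner_Integration.integral_cong) auto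
  then show ?thesis by simp
qed

text \<open>
  For given \<open>c\<close> and \<open>b\<close> the Volterra equation produces a function of the required shape; by linearity
  it is \<open>c g\<^sub>1 + b g\<^sub>2 + g\<^sub>3\<close>. The two periodicity conditions are linear equations for \<open>(c,b)\<close>. A
  nonzero solution of the homogeneous system would be a function with \<open>L\<^sub>W g = lam g\<close>, which vanishes
  by non-positivity, and then \<open>c + b W = 0\<close> forces \<open>c = b = 0\<close>. Hence the determinant is nonzero.
\<close>

lemma resolvent_graph_exists:
  assumes H: "H \<in> L2_torus" and lam: "lam > 0"
  shows "\<exists>g. LW_graph W g (\<lambda>x. lam * g x - H x)"
proof -
  note Hi = L2_integrable[OF H]
  obtain g1 where g1: "g1 \<in> Linf_torus" "\<And>x. x \<in> {0..<1} \<Longrightarrow> g1 x = 1 + lam * dprim g1 x"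
    using volterra_exists[of "\<lambda>_. 1" lam] lam Linf_torusI[of "\<lambda>_. 1" 1] by auto
  obtain g2 where g2: "g2 \<in> Linf_torus" "\<And>x. x \<in> {0..<1} \<Longrightarrow> g2 x = W x + lam * dprim g2 x"
    using volterra_exists[OF W_Linf, of lam] lam by auto
  have "(\<lambda>x. (-1) * dprim H x + 0 * dprim H x) \<in> Linf_torus"
    by (intro Linf_torus_lincomb dprim_Linf Hi)
  then obtain g3 where g3: "g3 \<in> Linf_torus" "\<And>x. x \<in> {0..<1} \<Longrightarrow> g3 x = - dprim H x + lam * dprim g3 x"
    using volterra_exists[of "\<lambda>x. - dprim H x" lam] lam by auto
  \<comment> \<open>\<open>e = 1\<close> is the inhomogeneous problem, \<open>e = 0\<close> the homogeneous one used for the determinant\<close>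
  define g where "g c b e x = c * g1 x + b * g2 x + e * g3 x" for c b e x
  define a1 where "a1 = lam * (LINT x|torus. g1 x)"
  define a2 where "a2 = lam * (LINT x|torus. g2 x)"
  define a3 where "a3 = lam * (LINT x|torus. g3 x) - (LINT x|torus. H x)"
  define b1 where "b1 = lam * dprim g1 1"
  define b2 where "b2 = W 1 + lam * dprim g2 1"
  define b3 where "b3 = lam * dprim g3 1 - dprim H 1"
  have i1: "integrable torus g1" and i2: "integrable torus g2" and i3: "integrable torus g3"
    using g1 g2 g3 Linf_torus_integrable by auto
  have gL: "g c b e \<in> Linf_torus" for c b e
  proof -
    have "g c b e = (\<lambda>x. 1 * (c * g1 x + b * g2 x) + e * g3 x)" by (auto simp: g_def)
    then show ?thesis using g1(1) g2(1) g3(1) by (simp only: Linf_torus_lincomb)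
  qed
  have dg: "dprim (\<lambda>x. lam * g c b e x - e * H x) x
      = c * (lam * dprim g1 x) + b * (lam * dprim g2 x) + e * (lam * dprim g3 x - dprim H x)" for c b e x
  proof -
    have "dprim (\<lambda>x. lam * g c b e x - e * H x) x = dprim (\<lambda>x. lam * g c b e x + (- e) * H x) x"
      by simp
    also have "\<dots> = lam * dprim (g c b e) x + (- e) * dprim H x"
      by (rule dprim_lincomb[OF Linf_torus_integrable[OF gL] Hi])
    also have "dprim (g c b e) x = dprim (\<lambda>x. 1 * (c * g1 x + b * g2 x) + e * g3 x) x"
      by (simp add: g_def[abs_def])
    also have "\<dots> = 1 * dprim (\<lambda>x. c * g1 x + b * g2 x) x + e * dprim g3 x"
      using i1 i2 i3 by (intro dprim_lincomb) auto
    also have "dprim (\<lambda>x. c * g1 x + b * g2 x) x = c * dprim g1 x + b * dprim g2 x"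
      by (rule dprim_lincomb[OF i1 i2])
    finally show ?thesis by (simp add: algebra_simps)
  qed
  have geq: "g c b e x = c + b * W x + dprim (\<lambda>x. lam * g c b e x - e * H x) x" if "x \<in> {0..<1}" for c b e x
  proof -
    have "c * g1 x = c * (1 + lam * dprim g1 x)" "b * g2 x = b * (W x + lam * dprim g2 x)"
      "e * g3 x = e * (- dprim H x + lam * dprim g3 x)"
      by (simp_all only: g1(2)[OF that, symmetric] g2(2)[OF that, symmetric] g3(2)[OF that, symmetric])
    then show ?thesis unfolding dg by (simp add: g_def algebra_simps)
  qed
  have graph: "LW_graph W (g c b e) (\<lambda>x. lam * g c b e x - e * H x)"
    if 1: "c * a1 + b * a2 + e * a3 = 0" and 2: "c * b1 + b * b2 + e * b3 = 0" for c b e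
  proof (rule LW_graphI)
    show "g c b e \<in> L2_torus" by (rule Linf_L2[OF gL])
    show "(\<lambda>x. lam * g c b e x - e * H x) \<in> L2_torus"
      using L2_lincomb[OF Linf_L2[OF gL] H, of lam c b e "- e"] by simp
    have "(LINT x|torus. lam * g c b e x - e * H x)
       = c * a1 + b * a2 + e * a3"
      using i1 i2 i3 Hi by (simp add: g_def a1_def a2_def a3_def algebra_simps)
    then show "(LINT x|torus. lam * g c b e x - e * H x) = 0" using 1 by simp
    show "b * W 1 + dprim (\<lambda>x. lam * g c b e x - e * H x) 1 = 0"
      unfolding dg using 2 by (simp add: b1_def b2_def b3_def algebra_simps)
    show "AE x in torus. g c b e x = c + b * W x + dprim (\<lambda>x. lam * g c b e x - e * H x) x"
      by (rule AE_I2) (use geq in simp)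
  qed
  have inj: "c = 0 \<and> b = 0" if 1: "c * a1 + b * a2 = 0" and 2: "c * b1 + b * b2 = 0" for c b
  proof -
    have gr: "LW_graph W (g c b 0) (\<lambda>x. lam * g c b 0 x)"
      using graph[of c b 0] 1 2 by simp
    have gL2: "g c b 0 \<in> L2_torus" by (rule Linf_L2[OF gL])
    have "lam * inner_torus (g c b 0) (g c b 0) \<le> 0"
      using LW_graph_nonpos[OF gr] inner_lincomb_left[OF gL2 gL2 gL2, of lam 0] by simp
    then have "inner_torus (g c b 0) (g c b 0) \<le> 0"
      using lam by (simp add: mult_le_0_iff)
    then have g0: "AE x in torus. g c b 0 x = 0"
      by (rule inner_self_le_0_imp[OF gL2])
    have d0: "dprim (\<lambda>x. lam * g c b 0 x - 0 * H x) x = 0" for x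
      by (rule dprim_cong_AE_0) (use g0 Linf_torus_measurable[OF gL] in auto)
    have "AE x in torus. x \<in> {0..<1}" by (rule AE_I2) simp
    with g0 have ae: "AE x in torus. c + b * W x = 0"
      by eventually_elim (use geq[of _ c b 0] d0 in simp)
    obtain x where x: "x \<in> {0<..<1/2}" "c + b * W x = 0"
      using AE_torus_ex[OF ae, of 0 "1/2"] by auto
    obtain y where y: "y \<in> {1/2<..<1}" "c + b * W y = 0"
      using AE_torus_ex[OF ae, of "1/2" 1] by auto
    have "W x < W y" using x y by (intro W_strict) auto
    moreover have "b * (W y - W x) = 0"
      unfolding right_diff_distrib using x(2) y(2) by linarith
    ultimately have "b = 0" by simp
    then show ?thesis using x by simp
  qed
  \<comment> \<open>the determinant of the two periodicity conditions; the solution below is Cramer's rule\<close>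
  define D where "D = a1 * b2 - a2 * b1"
  have "D \<noteq> 0"
  proof
    assume "D = 0"
    then have "a2 * b1 + (- a1) * b2 = 0" "b2 * a1 + (- b1) * a2 = 0"
      by (auto simp: D_def algebra_simps)
    then have "a2 = 0 \<and> - a1 = 0" "b2 = 0 \<and> - b1 = 0"
      using inj[of a2 "- a1"] inj[of b2 "- b1"] by (simp_all add: algebra_simps)
    then show False using inj[of 1 0] by simp
  qed
  define c where "c = (a2 * b3 - a3 * b2) / D"
  define b where "b = (a3 * b1 - a1 * b3) / D"
  have "c * a1 + b * a2 + 1 * a3 = ((a2 * b3 - a3 * b2) * a1 + (a3 * b1 - a1 * b3) * a2 + D * a3) / D"
    using \<open>D \<noteq> 0\<close> by (simp add: c_def b_def add_divide_distrib)
  also have "\<dots> = 0" by (simp add: D_def algebra_simps)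
  finally have 1: "c * a1 + b * a2 + 1 * a3 = 0" .
  have "c * b1 + b * b2 + 1 * b3 = ((a2 * b3 - a3 * b2) * b1 + (a3 * b1 - a1 * b3) * b2 + D * b3) / D"
    using \<open>D \<noteq> 0\<close> by (simp add: c_def b_def add_divide_distrib)
  also have "\<dots> = 0" by (simp add: D_def algebra_simps)
  finally have 2: "c * b1 + b * b2 + 1 * b3 = 0" .
  show ?thesis using graph[OF 1 2] by auto
qed

lemma LW_graph_LW: "f \<in> LW_domain W \<Longrightarrow> LW_graph W f (LW W f)"
  unfolding LW_domain_def LW_def mem_Collect_eq by (rule someI_ex[of "LW_graph W f"])

lemma LW_graph_diff:
  assumes "LW_graph W f \<ff>" "LW_graph W g \<gg>"
  shows "LW_graph W (\<lambda>x. f x - g x) (\<lambda>x. \<ff> x - \<gg> x)"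
  using LW_graph_lincomb[OF assms, of 1 "-1"] by simp

text \<open>
  The function chosen for \<open>L\<^sub>W g\<close> agrees with \<open>lam g - H\<close> by \<open>LW_graph_unique\<close>; thus the solutions found
  above satisfy the defining property of the resolvent.
\<close>

lemma resolvent_spec:
  assumes H: "H \<in> L2_torus" and lam: "lam > 0"
  shows "LW_graph W (resolvent W lam H) (LW W (resolvent W lam H))"
    and "AE x in torus. LW W (resolvent W lam H) x = lam * resolvent W lam H x - H x"
proof -
  obtain g where g: "LW_graph W g (\<lambda>x. lam * g x - H x)"
    using resolvent_graph_exists[OF assms] by blast
  then have gD: "g \<in> LW_domain W" by (auto simp: LW_domain_def)
  have "AE x in torus. LW W g x - (lam * g x - H x) = 0"
    by (rule LW_graph_unique[OF LW_graph_diff[OF LW_graph_LW[OF gD] g]]) simp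
  then have "AE x in torus. lam * g x - LW W g x = H x"
    by eventually_elim simp
  with gD have "g \<in> LW_domain W \<and> (AE x in torus. lam * g x - LW W g x = H x)" by blast
  then have *: "resolvent W lam H \<in> LW_domain W \<and>
      (AE x in torus. lam * resolvent W lam H x - LW W (resolvent W lam H) x = H x)"
    unfolding resolvent_def
    by (rule someI[where P = "\<lambda>g. g \<in> LW_domain W \<and> (AE x in torus. lam * g x - LW W g x = H x)"])
  then show "LW_graph W (resolvent W lam H) (LW W (resolvent W lam H))"
    by (blast intro: LW_graph_LW)
  from * have "AE x in torus. lam * resolvent W lam H x - LW W (resolvent W lam H) x = H x" by blast
  then show "AE x in torus. LW W (resolvent W lam H) x = lam * resolvent W lam H x - H x"
    by eventually_elim simp
qed

end

section \<open>The resolvent as a positive symmetric form\<close>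

locale conductance_resolvent = conductance +
  fixes lam :: real
  assumes lam_pos: "lam > 0"
begin

abbreviation "G \<equiv> resolvent W lam"
abbreviation "A H \<equiv> LW W (resolvent W lam H)"

lemma G_graph: "H \<in> L2_torus \<Longrightarrow> LW_graph W (G H) (A H)"
  by (rule resolvent_spec[OF _ lam_pos])

lemma A_eq: "H \<in> L2_torus \<Longrightarrow> AE x in torus. A H x = lam * G H x - H x"
  by (rule resolvent_spec[OF _ lam_pos])

lemma G_L2: "H \<in> L2_torus \<Longrightarrow> G H \<in> L2_torus"
  and A_L2: "H \<in> L2_torus \<Longrightarrow> A H \<in> L2_torus"
  using LW_graph_L2[OF G_graph] by auto

lemma inner_A:
  assumes "F \<in> L2_torus" "H \<in> L2_torus"
  shows "inner_torus F (A H) = lam * inner_torus F (G H) - inner_torus F H"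
proof -
  have L: "(\<lambda>x. lam * G H x - H x) \<in> L2_torus"
    using L2_lincomb[OF G_L2[OF assms(2)] assms(2), of lam "-1"] by simp
  have "inner_torus F (A H) = inner_torus F (\<lambda>x. lam * G H x - H x)"
    by (rule inner_cong_AE[OF _ A_eq[OF assms(2)]])
       (auto intro: L2_torus_measurable assms A_L2 L)
  also have "\<dots> = lam * inner_torus F (G H) - inner_torus F H"
    using inner_lincomb_right[OF G_L2[OF assms(2)] assms(2,1), of lam "-1"] by simp
  finally show ?thesis .
qed

lemma G_sym:
  assumes "H \<in> L2_torus" "K \<in> L2_torus"
  shows "inner_torus H (G K) = inner_torus (G H) K"
proof -
  have "inner_torus (G H) (A K) = inner_torus (G K) (A H)"
    using LW_graph_sym[OF G_graph[OF assms(1)] G_graph[OF assms(2)]]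
    by (simp add: inner_commute)
  then show ?thesis
    using inner_A[OF G_L2[OF assms(1)] assms(2)] inner_A[OF G_L2[OF assms(2)] assms(1)]
    by (simp add: inner_commute)
qed

lemma inner_G_ge:
  assumes "H \<in> L2_torus"
  shows "lam * inner_torus (G H) (G H) \<le> inner_torus H (G H)"
  using inner_A[OF G_L2[OF assms] assms] LW_graph_nonpos[OF G_graph[OF assms]]
  by (simp add: inner_commute)

lemma inner_G_nonneg:
  assumes "H \<in> L2_torus"
  shows "0 \<le> inner_torus H (G H)"
  using inner_G_ge[OF assms] inner_self_nonneg[of "G H"] lam_pos
  by (meson mult_nonneg_nonneg less_imp_le order_trans)

text \<open>
  The operator inequality \<open>lam G \<le> 1\<close>, obtained from \<open>\<langle>d, d\<rangle> \<ge> 0\<close> for \<open>d = H - lam G H\<close> and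
  \<open>inner_G_ge\<close>.
\<close>

lemma inner_G_le:
  assumes H: "H \<in> L2_torus"
  shows "lam * inner_torus H (G H) \<le> inner_torus H H"
proof -
  note GL = G_L2[OF H]
  let ?d = "\<lambda>x. 1 * H x + (- lam) * G H x"
  have dL: "?d \<in> L2_torus" by (rule L2_lincomb[OF H GL])
  have "0 \<le> inner_torus ?d ?d" by (rule inner_self_nonneg)
  also have "\<dots> = inner_torus H H - 2 * (lam * inner_torus H (G H)) + lam * (lam * inner_torus (G H) (G H))"
    unfolding inner_lincomb_left[OF H GL dL] inner_lincomb_right[OF H GL H] inner_lincomb_right[OF H GL GL]
    by (simp add: inner_commute algebra_simps)
  also have "\<dots> \<le> inner_torus H H - 2 * (lam * inner_torus H (G H)) + lam * inner_torus H (G H)"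
    using mult_left_mono[OF inner_G_ge[OF H], of lam] lam_pos by simp
  finally show ?thesis by simp
qed

text \<open>
  If \<open>G H = 0\<close> then \<open>A H = 0\<close> by \<open>LW_graph_unique\<close>, and \<open>H = lam G H - A H\<close>.
\<close>

lemma inner_G_eq_0:
  assumes H: "H \<in> L2_torus" and "inner_torus H (G H) \<le> 0"
  shows "AE x in torus. H x = 0"
proof -
  have "lam * inner_torus (G H) (G H) \<le> 0" using inner_G_ge[OF H] assms(2) by linarith
  then have "inner_torus (G H) (G H) \<le> 0" using lam_pos by (simp add: mult_le_0_iff)
  then have 0: "AE x in torus. G H x = 0" by (rule inner_self_le_0_imp[OF G_L2[OF H]])
  have "AE x in torus. A H x = 0" by (rule LW_graph_unique[OF G_graph[OF H] 0])
  with 0 A_eq[OF H] show ?thesis by eventually_elim simp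
qed

text \<open>
  The difference of two solutions is a function with \<open>L\<^sub>W d = lam d\<close>, which non-positivity rules out
  unless \<open>d = 0\<close>.
\<close>

lemma G_of_graph:
  assumes f: "LW_graph W f \<ff>"
  shows "AE x in torus. G (\<lambda>x. lam * f x - \<ff> x) x = f x"
proof -
  let ?K = "\<lambda>x. lam * f x - \<ff> x"
  have K: "?K \<in> L2_torus" using L2_lincomb[OF LW_graph_L2[OF f], of lam "-1"] by simp
  let ?d = "\<lambda>x. G ?K x - f x" and ?e = "\<lambda>x. A ?K x - \<ff> x"
  have de: "LW_graph W ?d ?e" by (rule LW_graph_diff[OF G_graph[OF K] f])
  note dL = LW_graph_L2(1)[OF de] and eL = LW_graph_L2(2)[OF de]
  have "inner_torus ?e ?d = inner_torus (\<lambda>x. lam * ?d x + 0 * ?d x) ?d"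
  proof (rule inner_cong_AE)
    show "AE x in torus. ?e x = lam * ?d x + 0 * ?d x"
      using A_eq[OF K] by eventually_elim (simp add: algebra_simps)
  qed (auto intro: L2_torus_measurable dL eL L2_lincomb[OF dL dL, of lam 0, simplified])
  also have "\<dots> = lam * inner_torus ?d ?d"
    using inner_lincomb_left[OF dL dL dL, of lam 0] by simp
  finally have "lam * inner_torus ?d ?d \<le> 0" using LW_graph_nonpos[OF de] by simp
  then have "inner_torus ?d ?d \<le> 0" using lam_pos by (simp add: mult_le_0_iff)
  then have "AE x in torus. ?d x = 0" by (rule inner_self_le_0_imp[OF dL])
  then show ?thesis by eventually_elim simp
qed

text \<open>
  The weight \<open>s\<close> is free here; its choice produces the rate of the exponential in the main estimate.
\<close>

lemma inner_G_Young:
  assumes F: "F \<in> L2_torus" and U: "U \<in> L2_torus" and s: "s > 0"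
  shows "2 * lam * inner_torus F (G U) \<le> inner_torus F F / s + lam * s * inner_torus U (G U)"
proof -
  let ?d = "\<lambda>x. 1 * F x + (- s) * U x"
  have dL: "?d \<in> L2_torus" by (rule L2_lincomb[OF F U])
  note GF = G_L2[OF F] and GU = G_L2[OF U]
  have "0 \<le> inner_torus ?d (G ?d)" by (rule inner_G_nonneg[OF dL])
  also have "\<dots> = inner_torus F (G ?d) - s * inner_torus U (G ?d)"
    using inner_lincomb_left[OF F U G_L2[OF dL], of 1 "- s"] by simp
  also have "inner_torus F (G ?d) = inner_torus F (G F) - s * inner_torus F (G U)"
    unfolding G_sym[OF F dL] using inner_lincomb_right[OF F U GF, of 1 "- s"]
    by (simp add: G_sym[OF F F] G_sym[OF F U])
  also have "inner_torus U (G ?d) = inner_torus F (G U) - s * inner_torus U (G U)"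
    unfolding G_sym[OF U dL] using inner_lincomb_right[OF F U GU, of 1 "- s"]
    by (simp add: inner_commute)
  finally have "2 * s * inner_torus F (G U) \<le> inner_torus F (G F) + s * s * inner_torus U (G U)"
    by (simp add: algebra_simps)
  from mult_left_mono[OF this, of "lam / s"]
  have "2 * lam * inner_torus F (G U) \<le> lam * inner_torus F (G F) / s + lam * s * inner_torus U (G U)"
    using s lam_pos by (simp add: field_simps)
  moreover have "lam * inner_torus F (G F) / s \<le> inner_torus F F / s"
    by (rule divide_right_mono[OF inner_G_le[OF F]]) (use s in simp)
  ultimately show ?thesis by linarith
qed

end

section \<open>Approximation of interval indicators\<close>

lemma prim_indicator:
  assumes "0 \<le> a" "a \<le> m" "m \<le> 1" "y \<le> 1"
  shows "prim (indicator {a..<m}) y = max 0 (min m y - a)"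
proof -
  have "prim (indicator {a..<m}) y = (LINT z|lebesgue. indicator {a..<min m y} z)"
    unfolding prim_def set_lebesgue_integral_def
    by (rule Bochner_Integration.integral_cong) (use assms in \<open>auto simp: indicator_def\<close>)
  also have "\<dots> = max 0 (min m y - a)" by (auto simp: max_def min_def)
  finally show ?thesis .
qed

text \<open>
  The cosine of the distance on the circle to the midpoint of \<open>(a,b)\<close> decreases with that distance;
  subtracting its value at the end points gives a smooth periodic function with these signs.
\<close>

lemma periodic_window_sign:
  assumes ab: "0 \<le> a" "a < b" "b \<le> 1" and x: "x \<in> {0<..<1::real}"
  shows "a < x \<Longrightarrow> x < b \<Longrightarrow> cos (pi * (b - a)) < cos (2 * pi * (x - (a + b) / 2))"
    and "x < a \<or> b < x \<Longrightarrow> cos (2 * pi * (x - (a + b) / 2)) < cos (pi * (b - a))"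
proof -
  define d where "d = 2 * pi * \<bar>x - (a + b) / 2\<bar>"
  have c: "cos (2 * pi * (x - (a + b) / 2)) = cos d"
  proof (cases "x - (a + b) / 2 \<ge> 0")
    case False
    then have "d = - (2 * pi * (x - (a + b) / 2))" by (simp add: d_def abs_if algebra_simps)
    then show ?thesis by (simp only: cos_minus)
  qed (simp add: d_def)
  have e: "2 * \<bar>x - (a + b) / 2\<bar> = \<bar>2 * x - a - b\<bar>"
    by (auto simp: abs_if field_simps)
  have d0: "0 \<le> d" by (simp add: d_def)
  have ba: "0 \<le> pi * (b - a)" "pi * (b - a) \<le> pi" using ab by (auto simp: mult_le_cancel_left1)
  { assume "a < x" "x < b"
    then have "2 * \<bar>x - (a + b) / 2\<bar> < b - a" unfolding e by linarith
    from mult_strict_left_mono[OF this pi_gt_zero] have "d < pi * (b - a)"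
      by (simp add: d_def mult_ac)
    then show "cos (pi * (b - a)) < cos (2 * pi * (x - (a + b) / 2))"
      unfolding c using d0 ba by (intro cos_monotone_0_pi) auto }
  { assume out: "x < a \<or> b < x"
    then have "b - a < 2 * \<bar>x - (a + b) / 2\<bar>" unfolding e by linarith
    from mult_strict_left_mono[OF this pi_gt_zero] have d1: "pi * (b - a) < d"
      by (simp add: d_def mult_ac)
    have "2 * \<bar>x - (a + b) / 2\<bar> < 2 - (b - a)" unfolding e using x ab out by auto
    from mult_strict_left_mono[OF this pi_gt_zero] have d2: "d < 2 * pi - pi * (b - a)"
      by (simp add: d_def algebra_simps)
    have "cos d < cos (pi * (b - a))"
    proof (cases "d \<le> pi")
      case True
      then show ?thesis using d1 ba by (intro cos_monotone_0_pi) auto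
    next
      case False
      have "cos d = cos (2 * pi - d)" by (simp add: cos_diff)
      also have "\<dots> < cos (pi * (b - a))"
        using False d2 ba by (intro cos_monotone_0_pi) auto
      finally show ?thesis .
    qed
    then show "cos (2 * pi * (x - (a + b) / 2)) < cos (pi * (b - a))" unfolding c . }
qed

text \<open>
  The function of \<open>periodic_window_sign\<close>, scaled by \<open>n\<close> and composed with a sigmoid.
\<close>

lemma C1_torus_indicator_limit:
  assumes ab: "0 \<le> a" "a < b" "b \<le> (1::real)"
  obtains H where "\<And>n::nat. H n \<in> C1_torus" "\<And>n x. \<bar>H n x\<bar> \<le> 1"
    "AE x in torus. (\<lambda>n. H n x) \<longlonglongrightarrow> indicator {a..<b} x"
proof
  define s where "s x = cos (2 * pi * (x - (a + b) / 2)) - cos (pi * (b - a))" for x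
  define H where "H n x = 1 / 2 + arctan (real n * s x) / pi" for n x
  show "H n \<in> C1_torus" for n
  proof -
    have "s (x + 1) = s x" for x
    proof -
      have "2 * pi * (x + 1 - (a + b) / 2) = 2 * pi * (x - (a + b) / 2) + 2 * pi"
        by (simp add: algebra_simps)
      then show ?thesis unfolding s_def by (simp only: cos_periodic)
    qed
    moreover have "(H n has_real_derivative 0 + (inverse (1 + (real n * s x)\<^sup>2) *
        (real n * (- sin (2 * pi * (x - (a + b) / 2)) * (2 * pi)))) / pi) (at x)" for x
    proof -
      have "(s has_real_derivative - sin (2 * pi * (x - (a + b) / 2)) * (2 * pi)) (at x)"
        unfolding s_def[abs_def] by (auto intro!: derivative_eq_intros)
      from DERIV_chain2[OF DERIV_arctan DERIV_cmult[OF this]] show ?thesis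
        unfolding H_def[abs_def] by (intro DERIV_add DERIV_const DERIV_cdivide)
    qed
    moreover have nz: "1 + (real n * s x)\<^sup>2 \<noteq> 0" for x
      by (metis add_pos_nonneg less_irrefl zero_le_power2 zero_less_one)
    have "continuous_on UNIV (\<lambda>x. 0 + (inverse (1 + (real n * s x)\<^sup>2) *
        (real n * (- sin (2 * pi * (x - (a + b) / 2)) * (2 * pi)))) / pi)"
      by (intro continuous_intros) (use nz in \<open>auto simp: s_def intro!: continuous_intros\<close>)
    ultimately show ?thesis
      unfolding C1_torus_def C1_differentiable_on_def has_real_derivative_iff_has_vector_derivative
      by (intro CollectI conjI exI[of _ "\<lambda>x. 0 + inverse (1 + (real n * s x)\<^sup>2) *
        (real n * (- sin (2 * pi * (x - (a + b) / 2)) * (2 * pi))) / pi"]) (auto simp: H_def)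
  qed
  show "\<bar>H n x\<bar> \<le> 1" for n x
  proof -
    have "\<bar>arctan (real n * s x)\<bar> \<le> pi / 2"
      using arctan_bounded[of "real n * s x"] by auto
    then have "\<bar>arctan (real n * s x) / pi\<bar> \<le> 1 / 2" by (simp add: field_simps)
    then show ?thesis unfolding H_def by linarith
  qed
  show "AE x in torus. (\<lambda>n. H n x) \<longlonglongrightarrow> indicator {a..<b} x"
  proof -
    have "AE x in torus. x \<in> {0<..<1}"
      using AE_torus_neq[of 0] AE_space by eventually_elim auto
    then show ?thesis
      using AE_torus_neq[of a] AE_torus_neq[of b]
    proof eventually_elim
      case (elim x)
      consider "a < x" "x < b" | "x < a \<or> b < x" using elim by linarith
      then show ?case
      proof cases
        case 1
        then have "s x > 0" using periodic_window_sign(1)[OF ab elim(1)] by (simp add: s_def)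
        then have "filterlim (\<lambda>n. s x * real n) at_top sequentially"
          by (intro filterlim_tendsto_pos_mult_at_top[OF tendsto_const _ filterlim_real_sequentially])
        then have "(\<lambda>n. arctan (real n * s x)) \<longlonglongrightarrow> pi / 2"
          using filterlim_compose[OF tendsto_arctan_at_top, of "\<lambda>n. s x * real n" sequentially]
          by (simp add: mult.commute)
        then have "(\<lambda>n. H n x) \<longlonglongrightarrow> 1 / 2 + pi / 2 / pi"
          unfolding H_def by (intro tendsto_intros) auto
        then show ?thesis using 1 by simp
      next
        case 2
        then have "- s x > 0" using periodic_window_sign(2)[OF ab elim(1)] by (simp add: s_def)
        then have "filterlim (\<lambda>n. - s x * real n) at_top sequentially"
          by (intro filterlim_tendsto_pos_mult_at_top[OF tendsto_const _ filterlim_real_sequentially])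
        then have "(\<lambda>n. arctan (- (real n * s x))) \<longlonglongrightarrow> pi / 2"
          using filterlim_compose[OF tendsto_arctan_at_top, of "\<lambda>n. - s x * real n" sequentially]
          by (simp add: mult.commute)
        then have "(\<lambda>n. arctan (real n * s x)) \<longlonglongrightarrow> - (pi / 2)"
          unfolding arctan_minus by (simp flip: tendsto_minus_cancel_left)
        then have "(\<lambda>n. H n x) \<longlonglongrightarrow> 1 / 2 + (- (pi / 2)) / pi"
          unfolding H_def by (intro tendsto_intros) auto
        then show ?thesis using 2 by (auto simp: indicator_def)
      qed
    qed
  qed
qed

lemma C1_torus_measurable: "H \<in> C1_torus \<Longrightarrow> H \<in> borel_measurable torus"
  by (auto simp: C1_torus_def intro!: borel_imp_torus_measurable borel_measurable_continuous_onI
      C1_differentiable_imp_continuous_on)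

context conductance begin

text \<open>
  A tent function supported in \<open>[a,e]\<close> is the primitive of a difference of two indicators. Its Stieltjes
  integral does all its growth within \<open>[a,e]\<close>, whether or not \<open>W\<close> jumps there;
  the total growth is positive because \<open>W\<close> is strictly increasing, and is normalised to 1.
\<close>

lemma bump_exists:
  assumes ae: "0 \<le> a" "a < e" "e \<le> 1"
  shows "\<exists>h\<in>Linf_torus. (LINT x|torus. h x) = 0 \<and> (\<forall>x\<le>a. dprim h x = 0) \<and>
    (\<forall>x\<ge>e. dprim h x = 1) \<and> (\<forall>x. 0 \<le> dprim h x \<and> dprim h x \<le> 1)"
proof -
  define m where "m = (a + e) / 2"
  define t :: "real \<Rightarrow> real" where "t x = 1 * indicator {a..<m} x + (-1) * indicator {m..<e} x" for x :: real
  have m: "a < m" "m < e" "2 * m = a + e" using ae by (auto simp: m_def)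
  have tL: "t \<in> Linf_torus" unfolding t_def[abs_def] by (intro Linf_torus_lincomb Linf_torus_indicator)
  note ti = Linf_torus_integrable[OF tL]
  have pt: "prim t y = max 0 (min m y - a) - max 0 (min e y - m)" if "y \<le> 1" for y
    using prim_lincomb[OF Linf_torus_integrable[OF Linf_torus_indicator] Linf_torus_integrable[OF Linf_torus_indicator] that, of 1 a m "-1" m e]
      prim_indicator[of a m y] prim_indicator[of m e y] ae m that by (simp add: t_def[abs_def])
  have p0: "0 \<le> prim t y" if "y \<le> 1" for y
    unfolding pt[OF that] using m by (auto simp: max_def min_def)
  have pout: "prim t y = 0" if "y \<le> 1" "y \<le> a \<or> e \<le> y" for y
    unfolding pt[OF that(1)] using m that by (auto simp: max_def min_def)
  have pm: "prim t m > 0" using pt[of m] m ae by auto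
  note pi = prim_mu_integrable[OF ti]
  define k where "k = (LINT y|mu. prim t y)"
  have "k \<ge> 0" unfolding k_def by (rule integral_nonneg_AE) (auto intro!: AE_I2 p0)
  moreover have "k \<noteq> 0"
  proof
    assume "k = 0"
    moreover have "AE y in mu. 0 \<le> prim t y" by (rule AE_I2) (simp add: p0)
    ultimately have "AE y in mu. prim t y = 0"
      using integral_nonneg_eq_0_iff_AE[OF pi] by (simp add: k_def)
    then have "prim t m = 0"
      by (rule continuous_AE_mu_0[rotated])
         (use m ae in \<open>auto intro: continuous_on_subset[OF continuous_on_prim[OF ti]]\<close>)
    then show False using pm by simp
  qed
  ultimately have k: "k > 0" by simp
  have d0: "dprim t x = 0" if "x \<le> a" for x
  proof -
    have "dprim t x = (LINT y|mu. 0)" unfolding dprim_def stieltjes_def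
      by (rule Bochner_Integration.integral_cong) (use that pout in \<open>auto simp: indicator_def\<close>)
    then show ?thesis by simp
  qed
  have d1: "dprim t x = k" if "x \<ge> e" for x
    unfolding dprim_def stieltjes_def k_def
    by (rule Bochner_Integration.integral_cong) (use that pout in \<open>auto simp: indicator_def\<close>)
  have dn: "0 \<le> dprim t x" for x
    unfolding dprim_def stieltjes_def
    by (rule integral_nonneg_AE) (auto intro!: AE_I2 p0 simp: indicator_def)
  have dk: "dprim t x \<le> k" for x
    unfolding dprim_def stieltjes_def k_def
    by (rule integral_mono) (use pi stieltjes_integrable[OF pi] p0 in \<open>auto simp: indicator_def\<close>)
  define h where "h x = (1 / k) * t x + 0 * t x" for x
  have dh: "dprim h x = dprim t x / k" for x
    using dprim_lincomb[OF ti ti, of "1 / k" 0 x] by (simp add: h_def[abs_def])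
  have "h \<in> Linf_torus" unfolding h_def[abs_def] by (intro Linf_torus_lincomb tL)
  moreover have "(LINT x|torus. t x) = 0"
    using pout[of 1] ae by (simp add: prim_1)
  then have "(LINT x|torus. h x) = 0" using ti by (simp add: h_def)
  ultimately show ?thesis using d0 d1 dn dk k by (intro bexI[of _ h]) (auto simp: dh)
qed

text \<open>
  The difference of a rise just after \<open>a\<close> and a rise just before \<open>b\<close> satisfies both periodicity
  conditions. Functions in the domain may jump only where \<open>W\<close> does, but as the rises take place in
  shrinking intervals inside \<open>[a,b]\<close>, their pointwise limit is the indicator off \<open>a\<close>.
\<close>

lemma domain_indicator_limit:
  assumes ab: "0 \<le> a" "a < b" "b \<le> (1::real)"
  obtains f \<ff> where "\<And>n::nat. LW_graph W (f n) (\<ff> n)" "\<And>n. f n \<in> Linf_torus" "\<And>n. \<ff> n \<in> Linf_torus"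
    "\<And>n x. \<bar>f n x\<bar> \<le> 1" "AE x in torus. (\<lambda>n. f n x) \<longlonglongrightarrow> indicator {a..<b} x"
proof -
  \<comment> \<open>the width of the rises; at most half of \<open>b - a\<close>, so that they do not overlap\<close>
  define d where "d n = (b - a) / (2 * real (Suc n))" for n
  have d: "0 < d n" "d n \<le> (b - a) / 2" for n
    unfolding d_def using ab divide_left_mono[of 2 "2 * real (Suc n)" "b - a"] by simp_all
  have "\<exists>h\<in>Linf_torus. (LINT x|torus. h x) = 0 \<and> (\<forall>x\<le>a. dprim h x = 0) \<and>
    (\<forall>x\<ge>a + d n. dprim h x = 1) \<and> (\<forall>x. 0 \<le> dprim h x \<and> dprim h x \<le> 1)" for n
    using d[of n] ab by (intro bump_exists) auto
  then obtain u where u: "\<And>n. u n \<in> Linf_torus" "\<And>n. (LINT x|torus. u n x) = 0"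
    "\<And>n x. x \<le> a \<Longrightarrow> dprim (u n) x = 0" "\<And>n x. x \<ge> a + d n \<Longrightarrow> dprim (u n) x = 1"
    "\<And>n x. 0 \<le> dprim (u n) x \<and> dprim (u n) x \<le> 1" by metis
  have "\<exists>h\<in>Linf_torus. (LINT x|torus. h x) = 0 \<and> (\<forall>x\<le>b - d n. dprim h x = 0) \<and>
    (\<forall>x\<ge>b. dprim h x = 1) \<and> (\<forall>x. 0 \<le> dprim h x \<and> dprim h x \<le> 1)" for n
    using d[of n] ab by (intro bump_exists) auto
  then obtain v where v: "\<And>n. v n \<in> Linf_torus" "\<And>n. (LINT x|torus. v n x) = 0"
    "\<And>n x. x \<le> b - d n \<Longrightarrow> dprim (v n) x = 0" "\<And>n x. x \<ge> b \<Longrightarrow> dprim (v n) x = 1"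
    "\<And>n x. 0 \<le> dprim (v n) x \<and> dprim (v n) x \<le> 1" by metis
  define w where "w n x = 1 * u n x + (-1) * v n x" for n x
  have wL: "w n \<in> Linf_torus" for n
    unfolding w_def[abs_def] by (intro Linf_torus_lincomb u v)
  note wi = Linf_torus_integrable[OF wL]
  have dw: "dprim (w n) x = dprim (u n) x - dprim (v n) x" for n x
    using dprim_lincomb[OF Linf_torus_integrable[OF u(1)[of n]] Linf_torus_integrable[OF v(1)[of n]], of 1 "-1" x]
    by (simp add: w_def[abs_def])
  show ?thesis
  proof (rule that[of "\<lambda>n. dprim (w n)" w])
    show "dprim (w n) \<in> Linf_torus" for n by (rule dprim_Linf[OF wi])
    show "w n \<in> Linf_torus" for n by (rule wL)
    show "LW_graph W (dprim (w n)) (w n)" for n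
    proof (rule LW_graphI[where c = 0 and b = 0])
      show "(LINT x|torus. w n x) = 0"
        using u(2)[of n] v(2)[of n] Linf_torus_integrable[OF u(1)[of n]] Linf_torus_integrable[OF v(1)[of n]]
        by (simp add: w_def)
      show "0 * W 1 + dprim (w n) 1 = 0"
        using u(4)[of n 1] v(4)[of 1 n] d[of n] ab by (simp add: dw)
    qed (auto intro: Linf_L2 wL dprim_Linf wi)
    show "\<bar>dprim (w n) x\<bar> \<le> 1" for n x
      using u(5)[of n x] v(5)[of n x] unfolding dw by linarith
    show "AE x in torus. (\<lambda>n. dprim (w n) x) \<longlonglongrightarrow> indicator {a..<b} x"
      using AE_torus_neq[of a]
    proof eventually_elim
      case (elim x)
      have dlim: "d \<longlonglongrightarrow> 0"
      proof -
        have "(\<lambda>n. ((b - a) / 2) * inverse (real (Suc n))) \<longlonglongrightarrow> ((b - a) / 2) * 0"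
          by (intro tendsto_intros LIMSEQ_inverse_real_of_nat)
        then show ?thesis by (simp add: d_def[abs_def] field_simps)
      qed
      have "\<forall>\<^sub>F n in sequentially. dprim (w n) x = indicator {a..<b} x"
      proof -
        consider "x < a" | "a < x" "x < b" | "b \<le> x" using elim by linarith
        then show ?thesis
        proof cases
          case 1
          then have "dprim (w n) x = 0" for n
            using u(3)[of x n] v(3)[of x n] d[of n] ab unfolding dw by auto
          then show ?thesis using 1 by simp
        next
          case 2
          have "\<forall>\<^sub>F n in sequentially. d n < x - a" "\<forall>\<^sub>F n in sequentially. d n < b - x"
            using order_tendstoD(2)[OF dlim] 2 by auto
          then show ?thesis
            by eventually_elim (use u(4) v(3) 2 in \<open>auto simp: dw\<close>)
        next
          case 3
          then have "dprim (w n) x = 0" for n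
            using u(4)[of n x] v(4)[of x n] d[of n] ab unfolding dw by auto
          then show ?thesis using 3 by simp
        qed
      qed
      then show ?case by (rule tendsto_eventually)
    qed
  qed
qed

end

section \<open>Extension of the weak formulation and weak continuity\<close>

lemma inner_self_le:
  assumes "F \<in> Linf_torus" "\<And>x. x \<in> {0..<1} \<Longrightarrow> \<bar>F x\<bar> \<le> C"
  shows "inner_torus F F \<le> C\<^sup>2"
proof -
  have "inner_torus F F \<le> (LINT x|torus. C\<^sup>2)"
    unfolding inner_torus_def
  proof (rule integral_mono)
    show "integrable torus (\<lambda>x. F x * F x)"
      by (rule L2_mult_integrable) (use assms(1) Linf_L2 in auto)
    show "F x * F x \<le> C\<^sup>2" if "x \<in> space torus" for x
      using power_mono[OF assms(2)[of x], of 2] that by (simp add: power2_eq_square)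
  qed simp
  then show ?thesis by (simp add: measure_restrict_space)
qed

context conductance_resolvent begin

lemma inner_A_lim:
  assumes F: "F \<in> L2_torus" and fm: "\<And>n. f n \<in> borel_measurable torus"
    and g: "g \<in> Linf_torus" and bd: "\<And>n x. x \<in> {0..<1} \<Longrightarrow> \<bar>f n x\<bar> \<le> C"
    and lim: "AE x in torus. (\<lambda>n. f n x) \<longlonglongrightarrow> g x"
  shows "(\<lambda>n. inner_torus F (G (f n))) \<longlonglongrightarrow> inner_torus F (G g)"
    and "(\<lambda>n. inner_torus F (A (f n))) \<longlonglongrightarrow> inner_torus F (A g)"
proof -
  have fL: "f n \<in> L2_torus" for n by (rule Linf_L2[OF Linf_torusI[OF fm bd]])
  have gL: "g \<in> L2_torus" by (rule Linf_L2[OF g])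
  show 1: "(\<lambda>n. inner_torus F (G (f n))) \<longlonglongrightarrow> inner_torus F (G g)"
    unfolding G_sym[OF F fL] G_sym[OF F gL]
    by (rule inner_bounded_lim[OF L2_integrable[OF G_L2[OF F]] fm g bd lim])
  show "(\<lambda>n. inner_torus F (A (f n))) \<longlonglongrightarrow> inner_torus F (A g)"
    unfolding inner_A[OF F fL] inner_A[OF F gL]
    by (intro tendsto_intros 1 inner_bounded_lim[OF L2_integrable[OF F] fm g bd lim])
qed

text \<open>
  A bound uniform in time, needed as a dominating function for the time integrals.
\<close>

lemma inner_A_bound:
  assumes F: "F \<in> L2_torus" and U: "U \<in> L2_torus"
  shows "\<bar>inner_torus F (A U)\<bar> \<le> inner_torus F F + inner_torus U U"
proof -
  have 1: "2 * lam * inner_torus F (G U) \<le> inner_torus F F + inner_torus U U" if "F \<in> L2_torus" for F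
    using inner_G_Young[OF that U, of 1] inner_G_le[OF U] by simp
  define N where "N = (\<lambda>x. (-1) * F x + 0 * F x)"
  have N: "N \<in> L2_torus" unfolding N_def by (rule L2_lincomb[OF F F])
  have i: "inner_torus N h = - inner_torus F h" if "h \<in> L2_torus" for h
    using inner_lincomb_left[OF F F that, of "-1" 0] by (simp add: N_def)
  have "inner_torus N N = inner_torus F F"
    using i[OF N] i[OF F] inner_commute[of F N] by simp
  then have 2: "- (2 * lam * inner_torus F (G U)) \<le> inner_torus F F + inner_torus U U"
    using 1[OF N] i[OF G_L2[OF U]] by simp
  have 3: "\<bar>2 * inner_torus F U\<bar> \<le> inner_torus F F + inner_torus U U"
  proof -
    let ?p = "\<lambda>x. 1 * F x + 1 * U x" and ?m = "\<lambda>x. 1 * F x + (-1) * U x"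
    have p: "?p \<in> L2_torus" and m: "?m \<in> L2_torus" by (intro L2_lincomb F U)+
    have "inner_torus ?p ?p = inner_torus F F + inner_torus U U + 2 * inner_torus F U"
      unfolding inner_lincomb_left[OF F U p] inner_lincomb_right[OF F U F] inner_lincomb_right[OF F U U]
      by (simp add: inner_commute[of U F])
    moreover have "inner_torus ?m ?m = inner_torus F F + inner_torus U U - 2 * inner_torus F U"
      unfolding inner_lincomb_left[OF F U m] inner_lincomb_right[OF F U F] inner_lincomb_right[OF F U U]
      by (simp add: inner_commute[of U F])
    ultimately show ?thesis using inner_self_nonneg[of ?p] inner_self_nonneg[of ?m] by linarith
  qed
  show ?thesis unfolding inner_A[OF F U] using 1[OF F] 2 3 by linarith
qed

lemma inner_G_lincomb:
  assumes F: "F \<in> L2_torus" and h: "h \<in> L2_torus" and k: "k \<in> L2_torus"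
  shows "inner_torus F (G (\<lambda>x. a * h x + b * k x)) = a * inner_torus F (G h) + b * inner_torus F (G k)"
    and "inner_torus F (A (\<lambda>x. a * h x + b * k x)) = a * inner_torus F (A h) + b * inner_torus F (A k)"
proof -
  note L = L2_lincomb[OF h k, of a b]
  show 1: "inner_torus F (G (\<lambda>x. a * h x + b * k x)) = a * inner_torus F (G h) + b * inner_torus F (G k)"
    unfolding G_sym[OF F L] G_sym[OF F h] G_sym[OF F k]
    by (rule inner_lincomb_right[OF h k G_L2[OF F]])
  show "inner_torus F (A (\<lambda>x. a * h x + b * k x)) = a * inner_torus F (A h) + b * inner_torus F (A k)"
    unfolding inner_A[OF F L] inner_A[OF F h] inner_A[OF F k] 1 inner_lincomb_right[OF h k F]
    by (simp add: algebra_simps)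
qed

text \<open>
  Moving the resolvent to the left factor, the weak formulation is preserved under
  bounded limits of the test function. It therefore extends, by \<open>bounded_measurable_induct\<close>, from
  the \<open>C\<^sup>1\<close> functions, among whose bounded limits are the interval indicators.
\<close>

lemma weak_form_bounded:
  fixes F :: "real \<Rightarrow> real \<Rightarrow> real"
  assumes F: "\<And>s. 0 \<le> s \<Longrightarrow> F s \<in> Linf_torus" "\<And>s x. 0 \<le> s \<Longrightarrow> x \<in> {0..<1} \<Longrightarrow> \<bar>F s x\<bar> \<le> K"
    and U: "U0 \<in> Linf_torus" "U1 \<in> Linf_torus"
    and C1: "\<And>H. H \<in> C1_torus \<Longrightarrow> set_integrable lebesgue {0..t} (\<lambda>s. inner_torus (F s) (A H)) \<and>
        inner_torus U1 (G H) - inner_torus U0 (G H) = (LINT s:{0..t}|lebesgue. inner_torus (F s) (A H))"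
    and h: "h \<in> Linf_torus"
  shows "set_integrable lebesgue {0..t} (\<lambda>s. inner_torus (F s) (A h)) \<and>
        inner_torus U1 (G h) - inner_torus U0 (G h) = (LINT s:{0..t}|lebesgue. inner_torus (F s) (A h))"
    (is "?P h")
proof -
  have closed: "?P g" if P: "\<And>n. ?P (f n)" and fm: "\<And>n. f n \<in> borel_measurable torus"
    and g: "g \<in> Linf_torus" and bd: "\<And>n x. x \<in> {0..<1} \<Longrightarrow> \<bar>f n x\<bar> \<le> C"
    and l: "AE x in torus. (\<lambda>n. f n x) \<longlonglongrightarrow> g x" for f g C
  proof -
    have fL: "f n \<in> Linf_torus" for n by (rule Linf_torusI[OF fm bd])
    note lims = inner_A_lim[OF _ fm g bd l]
    let ?f = "\<lambda>n s. indicator {0..t} s *\<^sub>R inner_torus (F s) (A (f n))"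
    let ?g = "\<lambda>s. indicator {0..t} s *\<^sub>R inner_torus (F s) (A g)"
    let ?w = "\<lambda>s. indicator {0..t} s *\<^sub>R (K\<^sup>2 + C\<^sup>2)"
    have pt: "(\<lambda>n. ?f n s) \<longlonglongrightarrow> ?g s" for s
    proof (cases "s \<in> {0..t}")
      case True
      then show ?thesis using lims(2)[OF Linf_L2[OF F(1)], of s] by simp
    qed simp
    have fi: "integrable lebesgue (?f n)" for n
      using P[of n] unfolding set_integrable_def by blast
    have w: "integrable lebesgue ?w"
      by (intro integrable_scaleR_left lmeasurable_iff_integrable[THEN iffD1] lmeasurable_interval)
    have dom: "norm (?f n s) \<le> ?w s" for n s
    proof (cases "s \<in> {0..t}")
      case True
      then have s: "0 \<le> s" by simp
      have "\<bar>inner_torus (F s) (A (f n))\<bar> \<le> inner_torus (F s) (F s) + inner_torus (f n) (f n)"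
        by (rule inner_A_bound[OF Linf_L2[OF F(1)[OF s]] Linf_L2[OF fL]])
      also have "\<dots> \<le> K\<^sup>2 + C\<^sup>2"
        by (intro add_mono inner_self_le F fL bd s)
      finally show ?thesis using True by simp
    qed simp
    have gm: "?g \<in> borel_measurable lebesgue"
      by (rule borel_measurable_LIMSEQ_real[where u = ?f]) (use pt fi in auto)
    note dc = gm borel_measurable_integrable[OF fi] w AE_I2[OF pt] AE_I2[OF dom]
    have gi: "integrable lebesgue ?g"
      by (rule integrable_dominated_convergence[OF dc])
    have l1: "(\<lambda>n. LINT s|lebesgue. ?f n s) \<longlonglongrightarrow> (LINT s|lebesgue. ?g s)"
      by (rule integral_dominated_convergence[OF dc])
    have eq: "(LINT s|lebesgue. ?f n s) = inner_torus U1 (G (f n)) - inner_torus U0 (G (f n))" for n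
      using P[of n] unfolding set_lebesgue_integral_def by (simp only:)
    have l2: "(\<lambda>n. inner_torus U1 (G (f n)) - inner_torus U0 (G (f n)))
        \<longlonglongrightarrow> inner_torus U1 (G g) - inner_torus U0 (G g)"
      by (intro tendsto_diff lims(1) Linf_L2 U)
    have "inner_torus U1 (G g) - inner_torus U0 (G g) = (LINT s|lebesgue. ?g s)"
      by (rule LIMSEQ_unique[OF l2 l1[unfolded eq]])
    then show ?thesis unfolding set_integrable_def set_lebesgue_integral_def using gi by blast
  qed
  show ?thesis
    using h
  proof (induction rule: bounded_measurable_induct)
    case (indicator a b)
    obtain H where H: "\<And>n::nat. H n \<in> C1_torus" "\<And>n x. \<bar>H n x\<bar> \<le> 1"
      "AE x in torus. (\<lambda>n. H n x) \<longlonglongrightarrow> indicator {a..<b} x"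
      using C1_torus_indicator_limit[OF indicator] by blast
    show ?case
      by (rule closed[OF C1[OF H(1)] C1_torus_measurable[OF H(1)] Linf_torus_indicator H(2,3)])
  next
    case (lincomb f g a b)
    note fL = Linf_L2[OF lincomb(1)] and gL = Linf_L2[OF lincomb(2)]
    have eq: "indicator {0..t} s *\<^sub>R inner_torus (F s) (A (\<lambda>x. a * f x + b * g x))
      = a * (indicator {0..t} s *\<^sub>R inner_torus (F s) (A f)) + b * (indicator {0..t} s *\<^sub>R inner_torus (F s) (A g))" for s
      using inner_G_lincomb(2)[OF Linf_L2[OF F(1)] fL gL, of s a b] by (auto simp: indicator_def)
    have i: "integrable lebesgue (\<lambda>s. indicator {0..t} s *\<^sub>R inner_torus (F s) (A f))"
      "integrable lebesgue (\<lambda>s. indicator {0..t} s *\<^sub>R inner_torus (F s) (A g))"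
      using lincomb(3,4) unfolding set_integrable_def by blast+
    note L1 = inner_G_lincomb(1)[OF Linf_L2[OF U(1)] fL gL] and L2 = inner_G_lincomb(1)[OF Linf_L2[OF U(2)] fL gL]
    have "inner_torus U1 (G (\<lambda>x. a * f x + b * g x)) - inner_torus U0 (G (\<lambda>x. a * f x + b * g x))
      = a * (inner_torus U1 (G f) - inner_torus U0 (G f)) + b * (inner_torus U1 (G g) - inner_torus U0 (G g))"
      unfolding L1 L2 by (simp add: right_diff_distrib)
    also have "\<dots> = (LINT s|lebesgue. a * (indicator {0..t} s *\<^sub>R inner_torus (F s) (A f)) + b * (indicator {0..t} s *\<^sub>R inner_torus (F s) (A g)))"
      using lincomb(3,4) i unfolding set_lebesgue_integral_def
      by (subst Bochner_Integration.integral_add) (simp_all only: integrable_mult_right integral_mult_right_zero)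
    finally show ?case
      unfolding set_integrable_def set_lebesgue_integral_def eq
      using i by (intro conjI Bochner_Integration.integrable_add integrable_mult_right)
  next
    case (lim f g C)
    show ?case by (rule closed[OF lim(1-5)])
  qed
qed

text \<open>
  Every \<open>f\<close> in the domain is a resolvent image, and the domain is dense in the sense of
  \<open>domain_indicator_limit\<close>. A bounded limit of test functions is a uniform limit in time because
  \<open>U\<close> is bounded.
\<close>

lemma weak_continuity:
  fixes U :: "real \<Rightarrow> real \<Rightarrow> real"
  assumes U: "\<And>t. 0 \<le> t \<Longrightarrow> U t \<in> Linf_torus" "\<And>t x. 0 \<le> t \<Longrightarrow> x \<in> {0..<1} \<Longrightarrow> \<bar>U t x\<bar> \<le> K"
    and c: "\<And>h. h \<in> Linf_torus \<Longrightarrow> continuous_on {0..T} (\<lambda>t. inner_torus (U t) (G h))"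
    and v: "v \<in> Linf_torus"
  shows "continuous_on {0..T} (\<lambda>t. inner_torus (U t) v)" (is "?P v")
proof -
  have closed: "?P g" if P: "\<And>n. ?P (f n)" and fm: "\<And>n. f n \<in> borel_measurable torus"
    and g: "g \<in> Linf_torus" and bd: "\<And>n x. x \<in> {0..<1} \<Longrightarrow> \<bar>f n x\<bar> \<le> C"
    and l: "AE x in torus. (\<lambda>n. f n x) \<longlonglongrightarrow> g x" for f g C
  proof -
    have fL: "f n \<in> Linf_torus" for n by (rule Linf_torusI[OF fm bd])
    have "\<forall>\<^sub>F n in sequentially. continuous_on {0..T} (\<lambda>t. inner_torus (U t) (f n))"
      using P by simp
    moreover have "uniform_limit {0..T} (\<lambda>n t. inner_torus (U t) (f n)) (\<lambda>t. inner_torus (U t) g) sequentially"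
    proof (rule uniform_limitI)
      fix e :: real assume e: "e > 0"
      define d where "d n = (LINT x|torus. \<bar>f n x - g x\<bar>)" for n
      obtain D where D: "0 \<le> D" "\<And>x. x \<in> {0..<1} \<Longrightarrow> \<bar>g x\<bar> \<le> D"
        using Linf_torus_bound[OF g] by blast
      have gm: "g \<in> borel_measurable torus" by (rule Linf_torus_measurable[OF g])
      have "(\<lambda>n. inner_torus (\<lambda>_. 1) (\<lambda>x. \<bar>f n x - g x\<bar>)) \<longlonglongrightarrow> inner_torus (\<lambda>_. 1) (\<lambda>_. 0)"
      proof (rule inner_bounded_lim[where C = "C + D"])
        show "(\<lambda>x. \<bar>f n x - g x\<bar>) \<in> borel_measurable torus" for n
          using fm[of n] gm by measurable
        show "(\<lambda>_. 0) \<in> Linf_torus" by (rule Linf_torusI[where C = 0]) auto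
        show "\<bar>\<bar>f n x - g x\<bar>\<bar> \<le> C + D" if "x \<in> {0..<1}" for n x
          using bd[OF that, of n] D(2)[OF that] by linarith
        show "AE x in torus. (\<lambda>n. \<bar>f n x - g x\<bar>) \<longlonglongrightarrow> 0"
          using l by eventually_elim (rule tendsto_rabs_zero, simp add: LIM_zero)
      qed simp
      then have "d \<longlonglongrightarrow> 0" by (simp add: inner_torus_def d_def[abs_def])
      then have "(\<lambda>n. K * d n) \<longlonglongrightarrow> K * 0" by (intro tendsto_intros)
      then have "\<forall>\<^sub>F n in sequentially. K * d n < e" using e by (intro order_tendstoD(2)) auto
      then show "\<forall>\<^sub>F n in sequentially. \<forall>t\<in>{0..T}. dist (inner_torus (U t) (f n)) (inner_torus (U t) g) < e"
      proof eventually_elim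
        case (elim n)
        show ?case
        proof
          fix t :: real assume "t \<in> {0..T}"
          then have t: "0 \<le> t" by simp
          have "inner_torus (U t) (f n) - inner_torus (U t) g = inner_torus (U t) (\<lambda>x. f n x - g x)"
            by (rule inner_diff_right[symmetric]) (auto intro: Linf_L2 fL g U t)
          also have "\<bar>\<dots>\<bar> \<le> (LINT x|torus. \<bar>U t x * (f n x - g x)\<bar>)"
            unfolding inner_torus_def by (rule integral_abs_bound)
          also have "\<dots> \<le> (LINT x|torus. K * \<bar>f n x - g x\<bar>)"
          proof (rule integral_mono)
            show "integrable torus (\<lambda>x. \<bar>U t x * (f n x - g x)\<bar>)"
              by (intro integrable_abs L2_mult_integrable L2_diff Linf_L2 fL g U t)
            show "integrable torus (\<lambda>x. K * \<bar>f n x - g x\<bar>)"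
              by (intro integrable_mult_right integrable_abs L2_integrable L2_diff Linf_L2 fL g)
            show "\<bar>U t x * (f n x - g x)\<bar> \<le> K * \<bar>f n x - g x\<bar>" if "x \<in> space torus" for x
              unfolding abs_mult by (rule mult_right_mono) (use U(2)[OF t, of x] that in auto)
          qed
          also have "\<dots> = K * d n" by (simp add: d_def)
          finally show "dist (inner_torus (U t) (f n)) (inner_torus (U t) g) < e"
            using elim by (simp add: dist_real_def)
        qed
      qed
    qed
    ultimately show ?thesis by (rule uniform_limit_theorem) simp
  qed
  show ?thesis
    using v
  proof (induction rule: bounded_measurable_induct)
    case (indicator a b)
    obtain f \<ff> where f: "\<And>n::nat. LW_graph W (f n) (\<ff> n)" "\<And>n. f n \<in> Linf_torus" "\<And>n. \<ff> n \<in> Linf_torus"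
    "\<And>n x. \<bar>f n x\<bar> \<le> 1" "AE x in torus. (\<lambda>n. f n x) \<longlonglongrightarrow> indicator {a..<b} x"
      using domain_indicator_limit[OF indicator] by blast
    have fc: "?P (f n)" for n
    proof -
      let ?h = "\<lambda>x. lam * f n x - \<ff> n x"
      have h: "?h \<in> Linf_torus" using Linf_torus_lincomb[OF f(2,3), of lam n "-1" n] by simp
      have eq: "inner_torus (U t) (f n) = inner_torus (U t) (G ?h)" if "t \<in> {0..T}" for t
      proof (rule inner_cong_AE)
        show "AE x in torus. f n x = G ?h x"
          using G_of_graph[OF f(1)[of n]] by eventually_elim simp
      qed (use that in \<open>auto intro: L2_torus_measurable G_L2 Linf_L2 f U h\<close>)
      from c[OF h] show ?thesis by (rule continuous_on_eq) (simp only: eq)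
    qed
    show ?case
      by (rule closed[where f = f and C = 1])
         (use f fc Linf_torus_measurable Linf_torus_indicator in auto)
  next
    case (lincomb f g a b)
    have eq: "inner_torus (U t) (\<lambda>x. a * f x + b * g x) = a * inner_torus (U t) f + b * inner_torus (U t) g"
      if "t \<in> {0..T}" for t
      by (rule inner_lincomb_right) (use that lincomb in \<open>auto intro: Linf_L2 U\<close>)
    have "continuous_on {0..T} (\<lambda>t. a * inner_torus (U t) f + b * inner_torus (U t) g)"
      using lincomb(3,4) by (intro continuous_intros)
    then show ?case by (rule continuous_on_eq) (simp only: eq)
  next
    case (lim f g C)
    show ?case by (rule closed[OF lim(1-5)])
  qed
qed

end

section \<open>The energy identity and Gronwall's inequality\<close>

lemma partition_point:
  fixes T \<tau> :: real and m :: nat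
  assumes \<tau>: "\<tau> \<in> {0<..T}" and m: "m > 0"
  shows "\<exists>j<m. \<forall>k. \<tau> \<in> {T * real k / real m<..T * real (Suc k) / real m} \<longleftrightarrow> k = j"
proof -
  define y where "y = \<tau> * real m / T"
  have T: "T > 0" using \<tau> by simp
  have y: "0 < y" "y \<le> real m" using \<tau> m T by (auto simp: y_def field_simps)
  define j where "j = nat (\<lceil>y\<rceil> - 1)"
  have j: "real j < y" "y \<le> real j + 1" using y unfolding j_def by linarith+
  have "j < m" using j y by linarith
  moreover have "\<tau> \<in> {T * real k / real m<..T * real (Suc k) / real m} \<longleftrightarrow> k = j" for k
  proof -
    have "\<tau> \<in> {T * real k / real m<..T * real (Suc k) / real m} \<longleftrightarrow> real k < y \<and> y \<le> real k + 1"
      using m T by (simp add: y_def field_simps)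
    also have "\<dots> \<longleftrightarrow> k = j" using j by (auto; linarith)
    finally show ?thesis .
  qed
  ultimately show ?thesis by blast
qed

text \<open>
  As \<open>N\<close> need not be differentiable, the comparison is with its majorant \<open>M(t) = N(0) + \<integral> k N\<close>, for which
  \<open>M(t) exp(- k t)\<close> is nonincreasing.
\<close>

lemma Gronwall_integral:
  fixes N m :: "real \<Rightarrow> real"
  assumes T: "T > 0" and m: "set_integrable lebesgue {0..T} m"
    and N: "\<And>t. t \<in> {0..T} \<Longrightarrow> N t = N 0 + (LINT s:{0..t}|lebesgue. m s)"
    and le: "\<And>s. s \<in> {0..T} \<Longrightarrow> m s \<le> k * N s" and k: "k \<ge> 0"
  shows "N T \<le> N 0 * exp (k * T)"
proof -
  have mt: "set_integrable lebesgue {0..t} m" if "t \<in> {0..T}" for t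
    by (rule set_integrable_subset[OF m]) (use that in auto)
  have Ni: "N t = N 0 + integral {0..t} m" if "t \<in> {0..T}" for t
    using N[OF that] set_lebesgue_integral_eq_integral(2)[OF mt[OF that]] by simp
  have "continuous_on {0..T} (\<lambda>t. N 0 + integral {0..t} m)"
    by (intro continuous_intros indefinite_integral_continuous_1 set_lebesgue_integral_eq_integral(1) m)
  then have cN: "continuous_on {0..T} N"
    by (rule continuous_on_eq) (rule Ni[symmetric])
  define M where "M t = N 0 + integral {0..t} (\<lambda>s. k * N s)" for t
  have NM: "N t \<le> M t" if t: "t \<in> {0..T}" for t
  proof -
    have "integral {0..t} m \<le> integral {0..t} (\<lambda>s. k * N s)"
    proof (rule integral_le)
      show "m integrable_on {0..t}" by (rule set_lebesgue_integral_eq_integral(1)[OF mt[OF t]])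
      show "(\<lambda>s. k * N s) integrable_on {0..t}"
        by (intro integrable_continuous_real continuous_intros continuous_on_subset[OF cN]) (use t in auto)
    qed (use le t in auto)
    then show ?thesis using Ni[OF t] by (simp add: M_def)
  qed
  have dM: "(M has_real_derivative k * N t) (at t within {0..T})" if t: "t \<in> {0..T}" for t
  proof -
    have "((\<lambda>u. integral {0..u} (\<lambda>s. k * N s)) has_vector_derivative k * N t) (at t within {0..T})"
      by (rule integral_has_vector_derivative[OF _ t]) (intro continuous_intros cN)
    then have "((\<lambda>u. integral {0..u} (\<lambda>s. k * N s)) has_real_derivative k * N t) (at t within {0..T})"
      by (simp add: has_real_derivative_iff_has_vector_derivative)
    from DERIV_add[OF DERIV_const this] show ?thesis by (simp add: M_def[abs_def])
  qed
  define E where "E t = M t * exp (- k * t)" for t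
  define E' where "E' t = k * (N t - M t) * exp (- k * t)" for t
  have dE: "(E has_derivative (*) (E' t)) (at t within {0..T})" if t: "0 \<le> t" "t \<le> T" for t
  proof -
    have dx: "((\<lambda>t. exp (- k * t)) has_real_derivative exp (- k * t) * - k) (at t within {0..T})"
      by (auto intro!: derivative_eq_intros)
    have "(E has_real_derivative k * N t * exp (- k * t) + (exp (- k * t) * - k) * M t) (at t within {0..T})"
      unfolding E_def[abs_def] using DERIV_mult[OF dM dx] t by simp
    then show ?thesis by (simp add: has_field_derivative_def E'_def algebra_simps)
  qed
  obtain \<xi> where x: "\<xi> \<in> {0<..<T}" "E T - E 0 = E' \<xi> * (T - 0)"
    using mvt_simple[OF T, of E "\<lambda>t. (*) (E' t)"] dE by auto
  have "E' \<xi> \<le> 0"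
  proof -
    have "k * (N \<xi> - M \<xi>) \<le> 0" using NM[of \<xi>] x k by (intro mult_nonneg_nonpos) auto
    then show ?thesis unfolding E'_def by (rule mult_nonpos_nonneg) simp
  qed
  then have "E' \<xi> * T \<le> 0" using T by (intro mult_nonpos_nonneg) auto
  then have "E T \<le> E 0" using x(2) by simp
  then have "M T * exp (- k * T) \<le> N 0" by (simp add: E_def M_def)
  from mult_right_mono[OF this, of "exp (k * T)"] have "M T \<le> N 0 * exp (k * T)"
    by (simp add: mult.assoc flip: exp_add)
  then show ?thesis using NM[of T] T by simp
qed

context conductance_resolvent begin

text \<open>
  The increments of \<open>\<langle>U\<^sub>t, G U\<^sub>t\<rangle>\<close> over a partition are exact time integrals of the pairing with
  \<open>A (U\<^sub>s + U\<^sub>t)\<close>, with \<open>s\<close> and \<open>t\<close> the end points of the cell. As the mesh tends to 0 both end points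
  converge to the integration variable \<open>\<tau>\<close>, and \<open>A (U\<^sub>s + U\<^sub>t)\<close> tends weakly to \<open>2 A U\<^sub>\<tau>\<close>. The same
  limit shows the integrand to be measurable.
\<close>

lemma energy_identity:
  fixes U F :: "real \<Rightarrow> real \<Rightarrow> real"
  assumes U: "\<And>t. 0 \<le> t \<Longrightarrow> U t \<in> Linf_torus" "\<And>t x. 0 \<le> t \<Longrightarrow> x \<in> {0..<1} \<Longrightarrow> \<bar>U t x\<bar> \<le> K"
    and F: "\<And>t. 0 \<le> t \<Longrightarrow> F t \<in> Linf_torus" "\<And>t x. 0 \<le> t \<Longrightarrow> x \<in> {0..<1} \<Longrightarrow> \<bar>F t x\<bar> \<le> L"
    and weak: "\<And>t h. 0 < t \<Longrightarrow> h \<in> Linf_torus \<Longrightarrow>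
        set_integrable lebesgue {0..t} (\<lambda>s. inner_torus (F s) (A h)) \<and>
        inner_torus (U t) (G h) - inner_torus (U 0) (G h) = (LINT s:{0..t}|lebesgue. inner_torus (F s) (A h))"
    and T: "T > 0"
  shows "set_integrable lebesgue {0<..T} (\<lambda>s. 2 * inner_torus (F s) (A (U s)))"
    and "inner_torus (U T) (G (U T)) - inner_torus (U 0) (G (U 0)) =
      (LINT s:{0<..T}|lebesgue. 2 * inner_torus (F s) (A (U s)))"
proof -
  note UL = Linf_L2[OF U(1)] and FL = Linf_L2[OF F(1)]
  define N where "N t = inner_torus (U t) (G (U t))" for t
  have incr: "set_integrable lebesgue {s<..t} (\<lambda>\<tau>. inner_torus (F \<tau>) (A h)) \<and>
      inner_torus (U t) (G h) - inner_torus (U s) (G h) = (LINT \<tau>:{s<..t}|lebesgue. inner_torus (F \<tau>) (A h))"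
    if st: "0 \<le> s" "s < t" and h: "h \<in> Linf_torus" for s t h
  proof -
    let ?f = "\<lambda>\<tau>. inner_torus (F \<tau>) (A h)"
    have t: "set_integrable lebesgue {0..t} ?f" using weak[of t h] st h by auto
    have i: "set_integrable lebesgue {0..s} ?f" "set_integrable lebesgue {s<..t} ?f"
      by (rule set_integrable_subset[OF t]; use st in auto)+
    have eq: "{0..t} = {0..s} \<union> {s<..t}" using st by auto
    have un: "(LINT \<tau>:{0..t}|lebesgue. ?f \<tau>) = (LINT \<tau>:{0..s}|lebesgue. ?f \<tau>) + (LINT \<tau>:{s<..t}|lebesgue. ?f \<tau>)"
      unfolding eq by (rule set_integral_Un[OF _ i]) auto
    have s: "(LINT \<tau>:{0..s}|lebesgue. ?f \<tau>) = inner_torus (U s) (G h) - inner_torus (U 0) (G h)"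
    proof (cases "s = 0")
      case True
      have "AE \<tau> in lebesgue. \<tau> \<noteq> (0::real)" by (rule AE_completion) (rule AE_lborel_singleton)
      then have "AE \<tau> in lebesgue. indicator {0..s} \<tau> *\<^sub>R ?f \<tau> = 0"
        by eventually_elim (auto simp: True indicator_def)
      then show ?thesis unfolding set_lebesgue_integral_def
        by (simp only: integral_eq_zero_AE True diff_self)
    next
      case False
      then show ?thesis using weak[of s h] st h by auto
    qed
    show ?thesis using weak[of t h] st h i(2) un s by auto
  qed
  define h where "h s t x = 1 * U t x + 1 * U s x" for s t x
  have hL: "h s t \<in> Linf_torus" if "0 \<le> s" "0 \<le> t" for s t
    unfolding h_def[abs_def] by (intro Linf_torus_lincomb U that)
  have Nincr: "N t - N s = inner_torus (U t) (G (h s t)) - inner_torus (U s) (G (h s t))"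
    if "0 \<le> s" "0 \<le> t" for s t
    unfolding h_def[abs_def] inner_G_lincomb(1)[OF UL[OF that(1)] UL[OF that(2)] UL[OF that(1)]]
      inner_G_lincomb(1)[OF UL[OF that(2)] UL[OF that(2)] UL[OF that(1)]]
    using G_sym[OF UL[OF that(1)] UL[OF that(2)]] by (simp add: N_def inner_commute)
  have cG: "continuous_on {0..T} (\<lambda>t. inner_torus (U t) (G h))" if hh: "h \<in> Linf_torus" for h
  proof -
    let ?f = "\<lambda>\<tau>. inner_torus (F \<tau>) (A h)"
    have i: "set_integrable lebesgue {0..T} ?f" using weak[OF T hh] by blast
    have "continuous_on {0..T} (\<lambda>t. inner_torus (U 0) (G h) + integral {0..t} ?f)"
      by (intro continuous_intros indefinite_integral_continuous_1 set_lebesgue_integral_eq_integral(1) i)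
    then show ?thesis
    proof (rule continuous_on_eq)
      fix t assume t: "t \<in> {0..T}"
      show "inner_torus (U 0) (G h) + integral {0..t} ?f = inner_torus (U t) (G h)"
      proof (cases "t = 0")
        case False
        then have "0 < t" using t by simp
        then show ?thesis
          using weak[of t h] hh set_lebesgue_integral_eq_integral(2)[of "{0..t}" ?f] by simp
      qed simp
    qed
  qed
  \<comment> \<open>by symmetry \<open>A\<close> acts on the fixed factor \<open>F\<^sub>\<tau>\<close>, leaving weak continuity of \<open>U\<close>\<close>
  have cA: "continuous_on {0..T} (\<lambda>t. inner_torus (F \<tau>) (A (U t)))" if "0 \<le> \<tau>" for \<tau>
  proof -
    have "continuous_on {0..T} (\<lambda>t. lam * inner_torus (U t) (G (F \<tau>)) - inner_torus (U t) (F \<tau>))"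
      by (intro continuous_intros cG weak_continuity[where U = U and K = K] U F that)
    then show ?thesis
    proof (rule continuous_on_eq)
      fix t assume "t \<in> {0..T}"
      then have t: "0 \<le> t" by simp
      show "lam * inner_torus (U t) (G (F \<tau>)) - inner_torus (U t) (F \<tau>) = inner_torus (F \<tau>) (A (U t))"
        unfolding inner_A[OF FL[OF that] UL[OF t]] G_sym[OF UL[OF t] FL[OF that]]
        by (simp add: inner_commute)
    qed
  qed
  define p where "p n k = T * real k / real (Suc n)" for n k
  have p0: "0 \<le> p n k" and pS: "p n k < p n (Suc k)" for n k
    using T by (auto simp: p_def divide_strict_right_mono)
  have pT: "p n (Suc n) = T" for n by (simp add: p_def)
  let ?phi = "\<lambda>n \<tau>. \<Sum>k<Suc n. indicator {p n k<..p n (Suc k)} \<tau> *\<^sub>R inner_torus (F \<tau>) (A (h (p n k) (p n (Suc k))))"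
  let ?g = "\<lambda>\<tau>. indicator {0<..T} \<tau> *\<^sub>R (2 * inner_torus (F \<tau>) (A (U \<tau>)))"
  let ?w = "\<lambda>\<tau>. indicator {0..T} \<tau> *\<^sub>R (L\<^sup>2 + (2 * K)\<^sup>2)"
  have phii: "integrable lebesgue (?phi n)" for n
    using incr[OF p0 pS hL[OF p0 p0]] unfolding set_integrable_def
    by (intro Bochner_Integration.integrable_sum) blast
  have phiI: "(LINT \<tau>|lebesgue. ?phi n \<tau>) = N T - N 0" for n
  proof -
    have "(LINT \<tau>|lebesgue. ?phi n \<tau>) = (\<Sum>k<Suc n. N (p n (Suc k)) - N (p n k))"
      using incr[OF p0 pS hL[OF p0 p0]] unfolding set_integrable_def set_lebesgue_integral_def
      by (subst Bochner_Integration.integral_sum) (auto simp: Nincr[OF p0 p0] simp del: sum.lessThan_Suc intro!: sum.cong)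
    also have "\<dots> = N T - N 0"
      by (subst sum_lessThan_telescope) (simp add: p_def)
    finally show ?thesis .
  qed
  have phi_at: "\<exists>j<Suc n. \<tau> \<in> {p n j<..p n (Suc j)} \<and> ?phi n \<tau> = inner_torus (F \<tau>) (A (h (p n j) (p n (Suc j))))"
    if \<tau>: "\<tau> \<in> {0<..T}" for n \<tau>
  proof -
    obtain j where j: "j < Suc n" "\<And>k. \<tau> \<in> {p n k<..p n (Suc k)} \<longleftrightarrow> k = j"
      using partition_point[OF \<tau>, of "Suc n"] unfolding p_def by blast
    have "?phi n \<tau> = (\<Sum>k<Suc n. if k = j then inner_torus (F \<tau>) (A (h (p n k) (p n (Suc k)))) else 0)"
    proof (rule sum.cong[OF refl])
      fix k
      show "indicator {p n k<..p n (Suc k)} \<tau> *\<^sub>R inner_torus (F \<tau>) (A (h (p n k) (p n (Suc k))))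
        = (if k = j then inner_torus (F \<tau>) (A (h (p n k) (p n (Suc k)))) else 0)"
        using j(2)[of k] unfolding indicator_def by simp
    qed
    also have "\<dots> = inner_torus (F \<tau>) (A (h (p n j) (p n (Suc j))))"
      using j(1) by (subst sum.delta) auto
    finally show ?thesis using j by blast
  qed
  have phi_out: "?phi n \<tau> = 0" if "\<tau> \<notin> {0<..T}" for n \<tau>
  proof (rule sum.neutral, rule ballI)
    fix k assume "k \<in> {..<Suc n}"
    then have "real (Suc k) \<le> real (Suc n)" by auto
    then have "p n (Suc k) \<le> T" using T unfolding p_def by (simp add: divide_le_eq mult_left_mono del: of_nat_Suc)
    then have "\<tau> \<notin> {p n k<..p n (Suc k)}" using that p0[of n k] by auto
    then show "indicator {p n k<..p n (Suc k)} \<tau> *\<^sub>R inner_torus (F \<tau>) (A (h (p n k) (p n (Suc k)))) = 0" by simp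
  qed
  have lim: "(\<lambda>n. ?phi n \<tau>) \<longlonglongrightarrow> ?g \<tau>" for \<tau>
  proof (cases "\<tau> \<in> {0<..T}")
    case False
    then show ?thesis unfolding phi_out[OF False] by simp
  next
    case True
    then have \<tau>0: "0 \<le> \<tau>" and \<tau>T: "\<tau> \<in> {0..T}" by auto
    obtain j where j: "\<And>n. j n < Suc n" "\<And>n. \<tau> \<in> {p n (j n)<..p n (Suc (j n))}"
      "\<And>n. ?phi n \<tau> = inner_torus (F \<tau>) (A (h (p n (j n)) (p n (Suc (j n)))))"
      using phi_at[OF True] by metis
    have step: "p n (Suc k) = p n k + T / real (Suc n)" for n k
      by (simp add: p_def add_divide_distrib distrib_left)
    have T0: "(\<lambda>n. T / real (Suc n)) \<longlonglongrightarrow> 0"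
      using tendsto_mult[OF tendsto_const LIMSEQ_inverse_real_of_nat, of T] by (simp add: divide_inverse)
    have l1: "(\<lambda>n. p n (j n)) \<longlonglongrightarrow> \<tau>"
    proof (rule tendsto_sandwich[of "\<lambda>n. \<tau> - T / real (Suc n)" _ _ "\<lambda>_. \<tau>"])
      show "(\<lambda>n. \<tau> - T / real (Suc n)) \<longlonglongrightarrow> \<tau>"
        using tendsto_diff[OF tendsto_const T0, of \<tau>] by simp
      show "\<forall>\<^sub>F n in sequentially. \<tau> - T / real (Suc n) \<le> p n (j n)"
      proof (intro always_eventually allI)
        fix n show "\<tau> - T / real (Suc n) \<le> p n (j n)" using j(2)[of n] step[of n "j n"] by simp
      qed
      show "\<forall>\<^sub>F n in sequentially. p n (j n) \<le> \<tau>"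
      proof (intro always_eventually allI)
        fix n show "p n (j n) \<le> \<tau>" using j(2)[of n] by simp
      qed
    qed simp
    have l2: "(\<lambda>n. p n (Suc (j n))) \<longlonglongrightarrow> \<tau>"
      unfolding step using tendsto_add[OF l1 T0] by simp
    have in1: "p n (j n) \<in> {0..T}" "p n (Suc (j n)) \<in> {0..T}" for n
    proof -
      have "real (Suc (j n)) \<le> real (Suc n)" using j(1)[of n] by simp
      then have "p n (Suc (j n)) \<le> T" using T unfolding p_def by (simp add: divide_le_eq mult_left_mono del: of_nat_Suc)
      then show "p n (j n) \<in> {0..T}" "p n (Suc (j n)) \<in> {0..T}" using p0 pS[of n "j n"] by auto
    qed
    have split: "inner_torus (F \<tau>) (A (h s t)) = inner_torus (F \<tau>) (A (U t)) + inner_torus (F \<tau>) (A (U s))"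
      if "0 \<le> s" "0 \<le> t" for s t
      unfolding h_def[abs_def] using inner_G_lincomb(2)[OF FL[OF \<tau>0] UL[OF that(2)] UL[OF that(1)], of 1 1]
      by simp
    have eq: "?phi n \<tau> = inner_torus (F \<tau>) (A (U (p n (Suc (j n))))) + inner_torus (F \<tau>) (A (U (p n (j n))))" for n
      unfolding j(3) by (rule split[OF p0 p0])
    have "(\<lambda>n. inner_torus (F \<tau>) (A (U (p n (Suc (j n))))) + inner_torus (F \<tau>) (A (U (p n (j n)))))
       \<longlonglongrightarrow> inner_torus (F \<tau>) (A (U \<tau>)) + inner_torus (F \<tau>) (A (U \<tau>))"
      by (intro tendsto_add continuous_on_tendsto_compose[OF cA[OF \<tau>0] l1 \<tau>T]
          continuous_on_tendsto_compose[OF cA[OF \<tau>0] l2 \<tau>T] always_eventually allI in1)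
    then show ?thesis unfolding eq using True by simp
  qed
  have w: "integrable lebesgue ?w"
    by (intro integrable_scaleR_left lmeasurable_iff_integrable[THEN iffD1] lmeasurable_interval)
  have dom: "norm (?phi n \<tau>) \<le> ?w \<tau>" for n \<tau>
  proof (cases "\<tau> \<in> {0<..T}")
    case False
    then show ?thesis unfolding phi_out[OF False] by simp
  next
    case True
    then have \<tau>0: "0 \<le> \<tau>" by auto
    obtain j where j: "?phi n \<tau> = inner_torus (F \<tau>) (A (h (p n j) (p n (Suc j))))"
      using phi_at[OF True] by blast
    let ?h = "h (p n j) (p n (Suc j))"
    have hb: "\<bar>?h x\<bar> \<le> 2 * K" if "x \<in> {0..<1}" for x
      using U(2)[OF p0[of n j] that] U(2)[OF p0[of n "Suc j"] that] unfolding h_def by simp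
    have "\<bar>inner_torus (F \<tau>) (A ?h)\<bar> \<le> inner_torus (F \<tau>) (F \<tau>) + inner_torus ?h ?h"
      by (rule inner_A_bound[OF FL[OF \<tau>0] Linf_L2[OF hL[OF p0 p0]]])
    also have "\<dots> \<le> L\<^sup>2 + (2 * K)\<^sup>2"
      by (intro add_mono inner_self_le F hL p0 hb \<tau>0)
    finally show ?thesis unfolding j using True by simp
  qed
  have gm: "?g \<in> borel_measurable lebesgue"
    by (rule borel_measurable_LIMSEQ_real[where u = ?phi]) (use lim phii in blast)+
  note dc = gm borel_measurable_integrable[OF phii] w AE_I2[OF lim] AE_I2[OF dom]
  show "set_integrable lebesgue {0<..T} (\<lambda>s. 2 * inner_torus (F s) (A (U s)))"
    unfolding set_integrable_def by (rule integrable_dominated_convergence[OF dc])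
  have "(\<lambda>n. LINT \<tau>|lebesgue. ?phi n \<tau>) \<longlonglongrightarrow> (LINT \<tau>|lebesgue. ?g \<tau>)"
    by (rule integral_dominated_convergence[OF dc])
  then have "(\<lambda>n::nat. N T - N 0) \<longlonglongrightarrow> (LINT \<tau>|lebesgue. ?g \<tau>)" unfolding phiI .
  then show "inner_torus (U T) (G (U T)) - inner_torus (U 0) (G (U 0)) =
      (LINT s:{0<..T}|lebesgue. 2 * inner_torus (F s) (A (U s)))"
    unfolding set_lebesgue_integral_def N_def by (simp only: LIMSEQ_const_iff)
qed

lemma energy_estimate:
  fixes U F :: "real \<Rightarrow> real \<Rightarrow> real"
  assumes U: "\<And>t. 0 \<le> t \<Longrightarrow> U t \<in> Linf_torus" "\<And>t x. 0 \<le> t \<Longrightarrow> x \<in> {0..<1} \<Longrightarrow> \<bar>U t x\<bar> \<le> K"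
    and F: "\<And>t. 0 \<le> t \<Longrightarrow> F t \<in> Linf_torus" "\<And>t x. 0 \<le> t \<Longrightarrow> x \<in> {0..<1} \<Longrightarrow> \<bar>F t x\<bar> \<le> L"
    and weak: "\<And>t h. 0 < t \<Longrightarrow> h \<in> Linf_torus \<Longrightarrow>
        set_integrable lebesgue {0..t} (\<lambda>s. inner_torus (F s) (A h)) \<and>
        inner_torus (U t) (G h) - inner_torus (U 0) (G h) = (LINT s:{0..t}|lebesgue. inner_torus (F s) (A h))"
    and B: "B > 0"
    and mono: "\<And>s x. 0 < s \<Longrightarrow> x \<in> {0..<1} \<Longrightarrow> F s x * F s x \<le> B * (F s x * U s x)"
    and T: "T > 0"
  shows "inner_torus (U T) (G (U T)) \<le> inner_torus (U 0) (G (U 0)) * exp (B * lam * T / 2)"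
proof -
  define N where "N t = inner_torus (U t) (G (U t))" for t
  \<comment> \<open>at time 0 the function \<open>F\<close> is unrelated to \<open>U\<close>, so the integrand is redefined there\<close>
  define m where "m s = (if s = 0 then 0 else 2 * inner_torus (F s) (A (U s)))" for s
  note UL = Linf_L2[OF U(1)] and FL = Linf_L2[OF F(1)]
  have m_ind: "indicator {0..t} s *\<^sub>R m s = indicator {0<..t} s *\<^sub>R (2 * inner_torus (F s) (A (U s)))" for s t
    by (auto simp: m_def indicator_def)
  have id: "set_integrable lebesgue {0<..t} (\<lambda>s. 2 * inner_torus (F s) (A (U s)))"
    "N t - N 0 = (LINT s:{0<..t}|lebesgue. 2 * inner_torus (F s) (A (U s)))" if "t > 0" for t
    unfolding N_def by (rule energy_identity[OF U F weak that]; assumption)+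
  have "N T \<le> N 0 * exp (B * lam / 2 * T)"
  proof (rule Gronwall_integral[OF T, of m])
    show "set_integrable lebesgue {0..T} m"
      using id(1)[OF T] unfolding set_integrable_def m_ind .
    show "N t = N 0 + (LINT s:{0..t}|lebesgue. m s)" if t: "t \<in> {0..T}" for t
    proof (cases "t = 0")
      case True
      have z: "indicator {0..t} s *\<^sub>R m s = 0" for s using True by (auto simp: m_def indicator_def)
      have "(LINT s:{0..t}|lebesgue. m s) = 0" unfolding set_lebesgue_integral_def z by simp
      then show ?thesis using True by simp
    next
      case False
      then have "t > 0" using t by simp
      from id(2)[OF this] show ?thesis
        unfolding set_lebesgue_integral_def m_ind by linarith
    qed
    show "m s \<le> B * lam / 2 * N s" if s: "s \<in> {0..T}" for s
    proof (cases "s = 0")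
      case True
      then show ?thesis using inner_G_nonneg[OF UL[of 0]] B lam_pos by (simp add: m_def N_def)
    next
      case False
      then have s: "0 < s" "0 \<le> s" using that by auto
      have "inner_torus (F s) (F s) \<le> (LINT x|torus. B * (F s x * U s x))"
        unfolding inner_torus_def
        by (rule integral_mono) (use mono[OF s(1)] L2_mult_integrable FL UL s in auto)
      then have "inner_torus (F s) (F s) \<le> B * inner_torus (F s) (U s)"
        by (simp add: inner_torus_def)
      then have 1: "inner_torus (F s) (F s) / (B / 2) \<le> 2 * inner_torus (F s) (U s)"
        using B by (simp add: field_simps)
      \<comment> \<open>the weight \<open>B/2\<close> makes the \<open>F\<close>-term exactly absorbable by step 1\<close>
      have 2: "2 * lam * inner_torus (F s) (G (U s)) \<le> inner_torus (F s) (F s) / (B / 2) + lam * (B / 2) * inner_torus (U s) (G (U s))"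
        using B by (intro inner_G_Young FL UL s) simp
      have "m s = 2 * lam * inner_torus (F s) (G (U s)) - 2 * inner_torus (F s) (U s)"
        unfolding m_def inner_A[OF FL[OF s(2)] UL[OF s(2)]] using False by simp
      also have "\<dots> \<le> lam * (B / 2) * inner_torus (U s) (G (U s))" using 1 2 by linarith
      finally show ?thesis by (simp add: N_def mult_ac)
    qed
    show "0 \<le> B * lam / 2" using B lam_pos by simp
  qed
  then show ?thesis by (simp add: N_def mult_ac)
qed

end

section \<open>Stability of weak solutions\<close>

lemma increment_square_le:
  fixes \<Phi> \<Phi>' :: "real \<Rightarrow> real"
  assumes d: "\<And>u. u \<in> {l..r} \<Longrightarrow> (\<Phi> has_real_derivative \<Phi>' u) (at u within {l..r})"
    and b: "\<And>u. u \<in> {l..r} \<Longrightarrow> 0 \<le> \<Phi>' u \<and> \<Phi>' u \<le> B"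
    and uv: "u \<in> {l..r}" "v \<in> {l..r}"
  shows "(\<Phi> u - \<Phi> v) * (\<Phi> u - \<Phi> v) \<le> B * ((\<Phi> u - \<Phi> v) * (u - v))"
proof -
  have *: "(\<Phi> v - \<Phi> u) * (\<Phi> v - \<Phi> u) \<le> B * ((\<Phi> v - \<Phi> u) * (v - u))"
    if uv: "u \<in> {l..r}" "v \<in> {l..r}" "u < v" for u v
  proof -
    have "(\<Phi> has_derivative (*) (\<Phi>' x)) (at x within {u..v})" if x: "u \<le> x" "x \<le> v" for x
    proof -
      have "(\<Phi> has_real_derivative \<Phi>' x) (at x within {u..v})"
        by (rule has_field_derivative_subset[OF d]) (use x uv in auto)
      then show ?thesis by (simp add: has_field_derivative_def)
    qed
    then obtain x where x: "x \<in> {u<..<v}" "\<Phi> v - \<Phi> u = \<Phi>' x * (v - u)"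
      using mvt_simple[OF uv(3), of \<Phi> "\<lambda>x. (*) (\<Phi>' x)"] by auto
    have "\<Phi>' x * (\<Phi>' x * (v - u)\<^sup>2) \<le> B * (\<Phi>' x * (v - u)\<^sup>2)"
      by (rule mult_right_mono) (use b[of x] x uv in auto)
    then show ?thesis unfolding x(2) by (simp add: power2_eq_square mult_ac)
  qed
  show ?thesis
  proof (cases u v rule: linorder_cases)
    case less
    from *[OF uv less] show ?thesis by (simp add: algebra_simps)
  next
    case greater
    from *[OF uv(2,1) greater] show ?thesis .
  qed simp
qed

lemma torus_measurable_compose:
  fixes \<Phi> :: "real \<Rightarrow> real"
  assumes c: "continuous_on {l..r} \<Phi>" and lr: "l \<le> r"
    and u: "u \<in> borel_measurable torus" "\<And>x. x \<in> {0..<1} \<Longrightarrow> u x \<in> {l..r}"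
  shows "(\<lambda>x. \<Phi> (u x)) \<in> borel_measurable torus"
proof -
  have "continuous_on UNIV (\<lambda>y. \<Phi> (max l (min r y)))"
    by (rule continuous_on_compose2[OF c]) (use lr in \<open>auto intro!: continuous_intros\<close>)
  from borel_measurable_continuous_on[OF this u(1)]
  have m: "(\<lambda>x. \<Phi> (max l (min r (u x)))) \<in> borel_measurable torus" .
  have eq: "\<Phi> (max l (min r (u x))) = \<Phi> (u x)" if "x \<in> space torus" for x
    using u(2)[of x] that by auto
  show ?thesis by (rule measurable_cong[THEN iffD1, OF eq m])
qed

context conductance_resolvent begin

text \<open>
  The weak formulation says nothing about \<open>\<rho>\<close> at time 0, so there \<open>U\<close> is set to the difference of
  the initial profiles.
\<close>

lemma weak_solution_estimate:
  fixes \<Phi> \<Phi>' :: "real \<Rightarrow> real"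
  assumes lr: "l < r"
    and d: "\<And>u. u \<in> {l..r} \<Longrightarrow> (\<Phi> has_real_derivative \<Phi>' u) (at u within {l..r})"
    and B: "B > 0" and b: "\<And>u. u \<in> {l..r} \<Longrightarrow> 0 \<le> \<Phi>' u \<and> \<Phi>' u \<le> B"
    and \<gamma>: "density_profile l r \<gamma>1" "density_profile l r \<gamma>2"
    and w1: "weak_solution W \<Phi> l r \<gamma>1 \<rho>1" and w2: "weak_solution W \<Phi> l r \<gamma>2 \<rho>2"
    and t: "t > 0"
  shows "inner_torus (\<lambda>x. \<rho>1 t x - \<rho>2 t x) (G (\<lambda>x. \<rho>1 t x - \<rho>2 t x))
     \<le> inner_torus (\<lambda>x. \<gamma>1 x - \<gamma>2 x) (G (\<lambda>x. \<gamma>1 x - \<gamma>2 x)) * exp (B * lam * t / 2)"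
proof -
  have cont: "continuous_on {l..r} \<Phi>"
    by (rule DERIV_continuous_on[OF d])
  obtain C where "\<forall>u\<in>{l..r}. \<bar>\<Phi> u\<bar> \<le> C"
    using compact_imp_bounded[OF compact_continuous_image[OF cont compact_Icc]]
    unfolding bounded_iff by auto
  then have C: "\<And>u. u \<in> {l..r} \<Longrightarrow> \<bar>\<Phi> u\<bar> \<le> C" by blast
  have L: "u \<in> Linf_torus" "(\<lambda>x. \<Phi> (u x)) \<in> Linf_torus"
    if u: "u \<in> borel_measurable torus" "\<And>x. x \<in> {0..<1} \<Longrightarrow> u x \<in> {l..r}" for u
  proof -
    show "u \<in> Linf_torus"
    proof (rule Linf_torusI[OF u(1)])
      show "\<bar>u x\<bar> \<le> \<bar>l\<bar> + \<bar>r\<bar>" if "x \<in> {0..<1}" for x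
        using u(2)[OF that] by auto
    qed
    show "(\<lambda>x. \<Phi> (u x)) \<in> Linf_torus"
    proof (rule Linf_torusI)
      show "(\<lambda>x. \<Phi> (u x)) \<in> borel_measurable torus"
        by (rule torus_measurable_compose[OF cont _ u]) (use lr in auto)
      show "\<bar>\<Phi> (u x)\<bar> \<le> C" if "x \<in> {0..<1}" for x
        by (rule C[OF u(2)[OF that]])
    qed
  qed
  have g: "\<gamma>1 \<in> borel_measurable torus" "\<gamma>2 \<in> borel_measurable torus"
    "\<And>x. x \<in> {0..<1} \<Longrightarrow> \<gamma>1 x \<in> {l..r}" "\<And>x. x \<in> {0..<1} \<Longrightarrow> \<gamma>2 x \<in> {l..r}"
    using \<gamma> unfolding density_profile_def by blast+
  have m: "\<rho>1 t \<in> borel_measurable torus" "\<rho>2 t \<in> borel_measurable torus" if "t \<ge> 0" for t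
    using w1 w2 that unfolding weak_solution_def by blast+
  have v: "\<rho>1 t x \<in> {l..r}" "\<rho>2 t x \<in> {l..r}" if "t \<ge> 0" "x \<in> {0..<1}" for t x
    using w1 w2 that unfolding weak_solution_def by blast+
  define U where "U t = (if t = 0 then (\<lambda>x. \<gamma>1 x - \<gamma>2 x) else (\<lambda>x. \<rho>1 t x - \<rho>2 t x))" for t
  define F where "F t x = \<Phi> (\<rho>1 t x) - \<Phi> (\<rho>2 t x)" for t x
  have diffL: "(\<lambda>x. f x - g x) \<in> Linf_torus" if "f \<in> Linf_torus" "g \<in> Linf_torus" for f g
    using Linf_torus_lincomb[OF that, of 1 "-1"] by simp
  have rL: "\<rho>1 t \<in> Linf_torus" "(\<lambda>x. \<Phi> (\<rho>1 t x)) \<in> Linf_torus"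
    "\<rho>2 t \<in> Linf_torus" "(\<lambda>x. \<Phi> (\<rho>2 t x)) \<in> Linf_torus" if "t \<ge> 0" for t
    using L[OF m(1)[OF that] v(1)[OF that]] L[OF m(2)[OF that] v(2)[OF that]] by auto
  have gL: "\<gamma>1 \<in> Linf_torus" "\<gamma>2 \<in> Linf_torus" using L(1)[OF g(1,3)] L(1)[OF g(2,4)] by blast+
  have UL: "U t \<in> Linf_torus" if "0 \<le> t" for t
    unfolding U_def using that rL gL by (auto intro: diffL)
  have Ub: "\<bar>U t x\<bar> \<le> r - l" if "0 \<le> t" "x \<in> {0..<1}" for t x
    using v[OF that] g(3,4)[OF that(2)] by (auto simp: U_def)
  have FL: "F t \<in> Linf_torus" if "0 \<le> t" for t
    unfolding F_def[abs_def] using rL[OF that] by (intro diffL)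
  have Fb: "\<bar>F t x\<bar> \<le> 2 * C" if "0 \<le> t" "x \<in> {0..<1}" for t x
    using C[OF v(1)[OF that]] C[OF v(2)[OF that]] unfolding F_def by linarith
  have C1: "set_integrable lebesgue {0..t} (\<lambda>s. inner_torus (F s) (A H)) \<and>
        inner_torus (U t) (G H) - inner_torus (U 0) (G H) = (LINT s:{0..t}|lebesgue. inner_torus (F s) (A H))"
    if t: "0 < t" and H: "H \<in> C1_torus" for t H
  proof -
    let ?f = "\<lambda>s. inner_torus (\<lambda>x. \<Phi> (\<rho>1 s x)) (A H)" and ?g = "\<lambda>s. inner_torus (\<lambda>x. \<Phi> (\<rho>2 s x)) (A H)"
    have i1: "set_integrable lebesgue {0..t} ?f"
      "inner_torus (\<rho>1 t) (G H) - inner_torus \<gamma>1 (G H) = (LINT s:{0..t}|lebesgue. ?f s)"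
      using w1 H t lam_pos unfolding weak_solution_def by blast+
    have i2: "set_integrable lebesgue {0..t} ?g"
      "inner_torus (\<rho>2 t) (G H) - inner_torus \<gamma>2 (G H) = (LINT s:{0..t}|lebesgue. ?g s)"
      using w2 H t lam_pos unfolding weak_solution_def by blast+
    have "continuous_on {0..1} H"
      using H by (auto simp: C1_torus_def intro: continuous_on_subset C1_differentiable_imp_continuous_on)
    then have "bounded (H ` {0..1})" by (intro compact_imp_bounded compact_continuous_image) auto
    then obtain D where "\<forall>x\<in>{0..1}. \<bar>H x\<bar> \<le> D" unfolding bounded_iff by auto
    then have HL: "H \<in> L2_torus"
      by (intro Linf_L2 Linf_torusI[where C = D] C1_torus_measurable[OF H]) auto
    have e: "indicator {0..t} s *\<^sub>R inner_torus (F s) (A H) = indicator {0..t} s *\<^sub>R (?f s - ?g s)" for s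
    proof (cases "s \<in> {0..t}")
      case True
      then have s: "0 \<le> s" by simp
      show ?thesis unfolding F_def[abs_def]
        using inner_diff_left[OF Linf_L2[OF rL(2)[OF s]] Linf_L2[OF rL(4)[OF s]] A_L2[OF HL]] by simp
    qed simp
    have "inner_torus (U t) (G H) - inner_torus (U 0) (G H)
       = (inner_torus (\<rho>1 t) (G H) - inner_torus \<gamma>1 (G H)) - (inner_torus (\<rho>2 t) (G H) - inner_torus \<gamma>2 (G H))"
      using t inner_diff_left[OF Linf_L2[OF rL(1)] Linf_L2[OF rL(3)] G_L2[OF HL], of t t]
        inner_diff_left[OF Linf_L2[OF gL(1)] Linf_L2[OF gL(2)] G_L2[OF HL]]
      by (simp add: U_def)
    also have "\<dots> = (LINT s:{0..t}|lebesgue. ?f s - ?g s)"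
      unfolding i1(2) i2(2) by (rule set_integral_diff(2)[symmetric, OF i1(1) i2(1)])
    finally show ?thesis
      using set_integral_diff(1)[OF i1(1) i2(1)]
      unfolding set_integrable_def set_lebesgue_integral_def e by blast
  qed
  have weak: "set_integrable lebesgue {0..t} (\<lambda>s. inner_torus (F s) (A h)) \<and>
        inner_torus (U t) (G h) - inner_torus (U 0) (G h) = (LINT s:{0..t}|lebesgue. inner_torus (F s) (A h))"
    if "0 < t" "h \<in> Linf_torus" for t h
    by (rule weak_form_bounded[where K = "2 * C"]) (use that FL Fb UL C1 in auto)
  have mono: "F s x * F s x \<le> B * (F s x * U s x)" if "0 < s" "x \<in> {0..<1}" for s x
    using increment_square_le[OF d b v(1)[of s x] v(2)[of s x]] that by (simp add: F_def U_def)
  have "inner_torus (U t) (G (U t)) \<le> inner_torus (U 0) (G (U 0)) * exp (B * lam * t / 2)"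
    by (rule energy_estimate[OF UL Ub FL Fb weak B mono t])
  then show ?thesis using t by (simp add: U_def)
qed

end

theorem lemma6p1:
  fixes W \<Phi> \<Phi>' :: "real \<Rightarrow> real" and l r B :: real
  assumes "conductance_function W"
    and "l < r"
    and "smooth_on_Icc l r \<Phi>"
    and "\<And>u. u \<in> {l..r} \<Longrightarrow> (\<Phi> has_real_derivative \<Phi>' u) (at u within {l..r})"
    and "0 < inverse B"
    and "\<And>u. u \<in> {l..r} \<Longrightarrow> inverse B \<le> \<Phi>' u \<and> \<Phi>' u \<le> B"
  shows "(\<forall>\<gamma>1 \<gamma>2 \<rho>1 \<rho>2.
            density_profile l r \<gamma>1 \<and> density_profile l r \<gamma>2 \<and>
            weak_solution W \<Phi> l r \<gamma>1 \<rho>1 \<and> weak_solution W \<Phi> l r \<gamma>2 \<rho>2 \<longrightarrow>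
            (\<forall>lam>0. \<forall>t>0.
               inner_torus (\<lambda>x. \<rho>1 t x - \<rho>2 t x) (resolvent W lam (\<lambda>x. \<rho>1 t x - \<rho>2 t x))
               \<le> inner_torus (\<lambda>x. \<gamma>1 x - \<gamma>2 x) (resolvent W lam (\<lambda>x. \<gamma>1 x - \<gamma>2 x))
                 * exp (B * lam * t / 2))) \<and>
         (\<forall>\<gamma> \<rho>1 \<rho>2.
            density_profile l r \<gamma> \<and>
            weak_solution W \<Phi> l r \<gamma> \<rho>1 \<and> weak_solution W \<Phi> l r \<gamma> \<rho>2 \<longrightarrow>
            (\<forall>t>0. AE x in torus. \<rho>1 t x = \<rho>2 t x))"
proof -
  have res: "conductance_resolvent W lam" if "lam > 0" for lam
    using assms(1) that by unfold_locales
  have B: "B > 0" using assms(5) by simp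
  have b: "\<And>u. u \<in> {l..r} \<Longrightarrow> 0 \<le> \<Phi>' u \<and> \<Phi>' u \<le> B"
    using assms(5,6) by (meson less_imp_le order_trans)
  have est: "inner_torus (\<lambda>x. \<rho>1 t x - \<rho>2 t x) (resolvent W lam (\<lambda>x. \<rho>1 t x - \<rho>2 t x))
      \<le> inner_torus (\<lambda>x. \<gamma>1 x - \<gamma>2 x) (resolvent W lam (\<lambda>x. \<gamma>1 x - \<gamma>2 x)) * exp (B * lam * t / 2)"
    if "density_profile l r \<gamma>1" "density_profile l r \<gamma>2"
      "weak_solution W \<Phi> l r \<gamma>1 \<rho>1" "weak_solution W \<Phi> l r \<gamma>2 \<rho>2" "lam > 0" "t > 0"
    for \<gamma>1 \<gamma>2 \<rho>1 \<rho>2 lam t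
    by (rule conductance_resolvent.weak_solution_estimate[OF res[OF that(5)] assms(2,4) B b that(1-4,6)])
  have "AE x in torus. \<rho>1 t x = \<rho>2 t x"
    if h: "density_profile l r \<gamma>" "weak_solution W \<Phi> l r \<gamma> \<rho>1" "weak_solution W \<Phi> l r \<gamma> \<rho>2" "t > 0"
    for \<gamma> \<rho>1 \<rho>2 t
  proof -
    let ?u = "\<lambda>x. \<rho>1 t x - \<rho>2 t x"
    have m: "\<rho>1 t \<in> borel_measurable torus" "\<rho>2 t \<in> borel_measurable torus"
      using h unfolding weak_solution_def by (meson less_imp_le)+
    have v: "\<rho>1 t x \<in> {l..r}" "\<rho>2 t x \<in> {l..r}" if "x \<in> {0..<1}" for x
      using h that unfolding weak_solution_def by (meson less_imp_le)+
    have "?u \<in> Linf_torus"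
    proof (rule Linf_torusI[where C = "r - l"])
      show "?u \<in> borel_measurable torus" using m by measurable
      show "\<bar>?u x\<bar> \<le> r - l" if "x \<in> {0..<1}" for x using v[OF that] by auto
    qed
    then have u: "?u \<in> L2_torus" by (rule Linf_L2)
    have "inner_torus ?u (resolvent W 1 ?u) \<le> 0"
      using est[OF h(1,1,2,3) zero_less_one h(4)] by (simp add: inner_torus_def)
    then have "AE x in torus. ?u x = 0"
      by (rule conductance_resolvent.inner_G_eq_0[OF res[OF zero_less_one] u])
    then show ?thesis by simp
  qed
  with est show ?thesis by blast
qed

end
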